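(* Let $d\geqslant 1$ and $s\geqslant 2$ be integers, and let $X$ be an $s$-distance set in $\mathbb{R}^{d}$ with $A(X)=\{\alpha_{1},\ldots,\alpha_{s}\}$. Let $N=\binom{d+s-1}{s-1}$. If $|X|\geqslant 2N$, then for each $i=1,2,\ldots,s$ the number \[ k_i=\prod_{\substack{1\leqslant j\leqslant s\\ j\neq i}}\frac{\alpha_{j}^{2}}{\alpha_{j}^{2}-\alpha_{i}^{2}} \] is an integer. Furthermore, for each $i=1,2,\ldots,s$, \[ |k_{i}|\leqslant \left\lfloor\frac{1}{2}+\sqrt{\frac{N^{2}}{2N-2}+\frac{1}{4}}\right\rfloor . \]
   Context: $\mathbb{R}^d$ is the $d$-dimensional Euclidean space with Euclidean norm $\|\cdot\|$, and $|\cdot|$ denotes cardinality. For a finite set $X\subset\mathbb{R}^d$, $A(X)=\{\|x-y\| : x,y\in X,\ x\neq y\}$ is the set of distances between distinct points of $X$. A finite set $X\subset\mathbb{R}^d$ is called an $s$-distance set if $|A(X)|=s$; thus $\alpha_1,\ldots,\alpha_s$ are pairwise distinct positive real numbers. *)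

theory Defs
  imports "HOL-Analysis.Analysis"
begin

definition distances :: "(real ^ 'n::finite) set \<Rightarrow> real set" where
  "distances X = {norm (x - y) | x y. x \<in> X \<and> y \<in> X \<and> x \<noteq> y}"

definition s_distance_set :: "nat \<Rightarrow> (real ^ 'n::finite) set \<Rightarrow> bool" where
  "s_distance_set s X \<longleftrightarrow> finite X \<and> card (distances X) = s"

definition distance_ratio :: "nat \<Rightarrow> (nat \<Rightarrow> real) \<Rightarrow> nat \<Rightarrow> real" where
  "distance_ratio s \<alpha> i = (\<Prod>j\<in>{1..s} - {i}. (\<alpha> j)\<^sup>2 / ((\<alpha> j)\<^sup>2 - (\<alpha> i)\<^sup>2))"

end

theory Submission
  imports Defs "HOL-Computational_Algebra.Fundamental_Theorem_Algebra"
begin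

text \<open>Let \<open>n = card X\<close>, let \<open>A\<^sub>i\<close> be the 0-1 matrix of the pairs of points at distance \<open>\<alpha> i\<close>, and
let \<open>k\<^sub>i\<close> be the ratio attached to \<open>\<alpha> i\<close>. Lagrange interpolation in \<open>\<bar>x - y\<bar>\<^sup>2\<close> writes
\<open>A\<^sub>i + k\<^sub>i I\<close> as a linear combination of the matrices \<open>D\<^sub>l = (\<bar>x - y\<bar>\<^sup>2\<^sup>l)\<close> with \<open>l < s\<close>. Every
monomial of \<open>\<bar>x - y\<bar>\<^sup>2\<^sup>l\<close> has total degree \<open>2l\<close>, hence degree at most \<open>l\<close> in \<open>x\<close> or in \<open>y\<close>.
So all \<open>D\<^sub>l\<close> with \<open>l < s\<close> vanish as quadratic forms on the space \<open>W\<close> of the vectors that are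
orthogonal to all polynomials of degree less than \<open>s\<close>, and \<open>v\<^sup>T A\<^sub>i v = - k\<^sub>i \<bar>v\<bar>\<^sup>2\<close> for \<open>v \<in> W\<close>
(\<open>adj_form\<close>). The codimension of \<open>W\<close> is at most \<open>N\<close>.

The bound. On \<open>W\<close> the matrix \<open>J - I - 2 A\<^sub>i\<close>, with zero diagonal and entries \<open>1\<close> and \<open>-1\<close> off it,
acts as the form \<open>(2 k\<^sub>i - 1) \<bar>v\<bar>\<^sup>2\<close>. A matrix of trace zero with entries of absolute value at most 1
cannot have a large scalar compression to a space of dimension \<open>n - N \<ge> n / 2\<close>
(\<open>sign_matrix_compression_bound\<close>), which yields \<open>(2 k\<^sub>i - 1)\<^sup>2 \<le> 2 N - 1\<close>.

Rationality. Let \<open>B\<^sub>j\<close> be the compression of \<open>A\<^sub>j\<close> to the vectors of sum zero; it is a rational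
matrix. For a tuple \<open>\<theta>\<close> let \<open>E(\<theta>)\<close> be the joint eigenspace of \<open>B\<^sub>1, \<dots>, B\<^sub>s\<close> on the vectors of sum
zero. Let \<open>q\<close> be the number of monomials of degree \<open>s - 1\<close>.

  \<^item> \<open>E(- k)\<close> has dimension greater than \<open>q\<close>, since \<open>n \<ge> 2 N\<close>: it contains the vectors of \<open>W\<close> that also kill the
    functions \<open>\<bar>x\<bar>\<^sup>2\<^sup>b M(x)\<close>, \<open>b + deg M < s\<close>, other than \<open>\<bar>x\<bar>\<^sup>2\<^sup>(\<^sup>s\<^sup>-\<^sup>1\<^sup>)\<close>, and modulo polynomials of degree
    less than \<open>s\<close> these functions span a space of dimension less than \<open>N - q\<close>
    (\<open>eigenspace_not_separated\<close>).
  \<^item> Every other \<open>E(\<theta>)\<close> has dimension at most \<open>q\<close>. On it each \<open>D\<^sub>l\<close> with \<open>0 < l < s\<close> is a scalar form.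
    On vectors that kill the polynomials of degree less than \<open>l\<close> the form \<open>D\<^sub>l\<close> is up to sign a
    nonnegative combination of squares of moments of degree \<open>l\<close>, and it vanishes only if all these
    moments do. If all the scalars are zero, then \<open>E(\<theta>) \<subseteq> W\<close> by
    induction on the degree, and \<open>\<theta> = - k\<close> unless \<open>E(\<theta>)\<close> is trivial. Otherwise the first nonzero
    scalar shows that the moments of that degree are injective on \<open>E(\<theta>)\<close>
    (\<open>other_eigenspaces_separated\<close>).

A Galois conjugate of \<open>- k\<close> would have a joint eigenspace of the same dimension, so \<open>k\<close> must be
rational. The argument \<open>exceptional_eigenvalue_rational\<close> proves this without number fields: vectors
of \<open>E(- k)\<close> orthogonal to \<open>q\<close> generic rational vectors have a rational hull inside \<open>E(- k)\<close>, and any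
nonzero rational vector in \<open>E(- k)\<close> makes the eigenvalues rational. Finally \<open>A\<^sub>i\<close> itself has the
eigenvalue \<open>- k\<^sub>i\<close>, and a rational eigenvalue of an integer matrix is an integer.\<close>

section \<open>Vectors on a finite set and symmetric kernels\<close>

definition dot :: "'a set \<Rightarrow> ('a \<Rightarrow> real) \<Rightarrow> ('a \<Rightarrow> real) \<Rightarrow> real" where
  "dot X u v = (\<Sum>x\<in>X. u x * v x)"

lemma dot_commute: "dot X u v = dot X v u"
  by (simp add: dot_def mult.commute)

lemma dot_comb: "dot X u (\<lambda>x. a * v x + b * w x) = a * dot X u v + b * dot X u w"
  by (simp add: dot_def sum.distrib sum_distrib_left algebra_simps)

lemma dot_comb_left: "dot X (\<lambda>x. a * v x + b * w x) u = a * dot X v u + b * dot X w u"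
  by (simp add: dot_def sum.distrib sum_distrib_left algebra_simps)

lemma dot_zero_right [simp]: "dot X u (\<lambda>_. 0) = 0"
  by (simp add: dot_def)

lemma dot_self_eq_0: "finite X \<Longrightarrow> dot X v v = 0 \<Longrightarrow> x \<in> X \<Longrightarrow> v x = 0"
  by (simp add: dot_def sum_nonneg_eq_0_iff)

lemma dot_self_nonneg: "dot X v v \<ge> 0"
  by (simp add: dot_def sum_nonneg)

text \<open>The elimination step behind all dimension counts below: subspaces are described by the functionals
that vanish on them or that separate their points, so that no bases have to be chosen.\<close>
lemma underdetermined_system:
  fixes X :: "'a set"
  assumes "finite X" "finite J" "card J < card X"
  shows "\<exists>v. (\<exists>x\<in>X. v x \<noteq> 0) \<and> (\<forall>j\<in>J. dot X (g j) v = 0)"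
  using assms(2,1,3)
proof (induction J arbitrary: X g rule: finite_induct)
  case empty
  then obtain x where "x \<in> X" by fastforce
  then show ?case by (intro exI[of _ "\<lambda>_. 1"]) auto
next
  case (insert j J)
  show ?case
  proof (cases "\<forall>x\<in>X. g j x = 0")
    case True
    have "card J < card X" using insert by simp
    from insert.IH[OF insert.prems(1) this, of g] True show ?thesis
      by (auto simp: dot_def)
  next
    case False
    then obtain x0 where x0: "x0 \<in> X" "g j x0 \<noteq> 0" by blast
    define g' where "g' = (\<lambda>i x. g i x - g i x0 / g j x0 * g j x)"
    have "card J < card (X - {x0})" using insert x0 by simp
    from insert.IH[OF _ this, of g'] insert.prems(1) obtain v where
      v: "\<exists>x\<in>X - {x0}. v x \<noteq> 0" "\<And>i. i \<in> J \<Longrightarrow> dot (X - {x0}) (g' i) v = 0" by auto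
    define c where "c = - dot (X - {x0}) (g j) v / g j x0"
    define v' where "v' = v(x0 := c)"
    have split: "dot X f v' = f x0 * c + dot (X - {x0}) f v" for f
      unfolding dot_def using insert.prems(1) x0(1)
      by (subst sum.remove[of X x0]) (auto simp: v'_def intro!: sum.cong)
    have "dot X (g i) v' = 0" if "i \<in> J" for i
    proof -
      have "0 = dot (X - {x0}) (g' i) v" using v(2) that by simp
      also have "\<dots> = dot (X - {x0}) (g i) v - g i x0 / g j x0 * dot (X - {x0}) (g j) v"
        by (simp add: dot_def g'_def algebra_simps sum_subtractf sum_distrib_left)
      finally show ?thesis using x0 by (simp add: split c_def)
    qed
    moreover have "dot X (g j) v' = 0" using x0 by (simp add: split c_def)
    moreover have "\<exists>x\<in>X. v' x \<noteq> 0" using v(1) by (auto simp: v'_def)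
    ultimately show ?thesis by blast
  qed
qed

text \<open>Vectors are required to vanish off \<open>X\<close>, so that vectors that agree on \<open>X\<close> are equal as functions.\<close>
definition subspace_on :: "'a set \<Rightarrow> ('a \<Rightarrow> real) set \<Rightarrow> bool" where
  "subspace_on X S \<longleftrightarrow> (\<forall>v\<in>S. \<forall>x. x \<notin> X \<longrightarrow> v x = 0) \<and> (\<lambda>_. 0) \<in> S \<and>
     (\<forall>u\<in>S. \<forall>v\<in>S. \<forall>a b. (\<lambda>x. a * u x + b * v x) \<in> S)"

lemma subspace_onD:
  assumes "subspace_on X S"
  shows "v \<in> S \<Longrightarrow> x \<notin> X \<Longrightarrow> v x = 0" "(\<lambda>_. 0) \<in> S"
    "u \<in> S \<Longrightarrow> v \<in> S \<Longrightarrow> (\<lambda>x. a * u x + b * v x) \<in> S"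
    "v \<in> S \<Longrightarrow> (\<lambda>x. a * v x) \<in> S"
proof -
  show 1: "v \<in> S \<Longrightarrow> x \<notin> X \<Longrightarrow> v x = 0" "(\<lambda>_. 0) \<in> S"
    "u \<in> S \<Longrightarrow> v \<in> S \<Longrightarrow> (\<lambda>x. a * u x + b * v x) \<in> S"
    using assms unfolding subspace_on_def by blast+
  assume "v \<in> S"
  then have "(\<lambda>x. a * v x + 0 * v x) \<in> S"
    using assms unfolding subspace_on_def by blast
  then show "(\<lambda>x. a * v x) \<in> S" by simp
qed

lemma subspace_on_dot_self:
  assumes "subspace_on X S" "finite X" "v \<in> S" "dot X v v = 0"
  shows "v = (\<lambda>_. 0)"
  using dot_self_eq_0[OF assms(2,4)] subspace_onD(1)[OF assms(1,3)] by (metis ext)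

definition app :: "'a set \<Rightarrow> ('a \<Rightarrow> 'a \<Rightarrow> real) \<Rightarrow> ('a \<Rightarrow> real) \<Rightarrow> 'a \<Rightarrow> real" where
  "app X b v = (\<lambda>x. if x \<in> X then dot X (b x) v else 0)"

lemma app_comb: "app X b (\<lambda>x. a * v x + c * w x) = (\<lambda>x. a * app X b v x + c * app X b w x)"
  by (auto simp: app_def dot_comb)

lemma app_scale: "app X b (\<lambda>x. a * v x) = (\<lambda>x. a * app X b v x)"
  using app_comb[of X b a v 0 v] by simp

definition symmetric_kernel :: "('a \<Rightarrow> 'a \<Rightarrow> real) \<Rightarrow> bool" where
  "symmetric_kernel b \<longleftrightarrow> (\<forall>x y. b x y = b y x)"

lemma app_symmetric:
  assumes "symmetric_kernel b"
  shows "dot X u (app X b v) = dot X (app X b u) v"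
proof -
  have "dot X u (app X b v) = (\<Sum>x\<in>X. \<Sum>y\<in>X. u x * (b x y * v y))"
    by (simp add: dot_def app_def sum_distrib_left)
  also have "\<dots> = (\<Sum>y\<in>X. \<Sum>x\<in>X. u x * (b x y * v y))" by (rule sum.swap)
  also have "\<dots> = (\<Sum>y\<in>X. \<Sum>x\<in>X. b y x * u x * v y)"
    using assms by (intro sum.cong refl) (simp add: symmetric_kernel_def mult_ac)
  also have "\<dots> = dot X (app X b u) v"
    by (simp add: dot_def app_def sum_distrib_right)
  finally show ?thesis .
qed

definition capp :: "'a set \<Rightarrow> ('a \<Rightarrow> 'a \<Rightarrow> real) \<Rightarrow> ('a \<Rightarrow> complex) \<Rightarrow> 'a \<Rightarrow> complex" where
  "capp X b u = (\<lambda>x. Complex (app X b (\<lambda>y. Re (u y)) x) (app X b (\<lambda>y. Im (u y)) x))"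

text \<open>Horner's scheme for the value of the polynomial \<open>p\<close> at the operator \<open>capp X b\<close>, applied to \<open>u\<close>.\<close>
definition peval :: "'a set \<Rightarrow> ('a \<Rightarrow> 'a \<Rightarrow> real) \<Rightarrow> ('a \<Rightarrow> complex) \<Rightarrow> complex poly \<Rightarrow> 'a \<Rightarrow> complex" where
  "peval X b u p = fold_coeffs (\<lambda>a f x. a * u x + capp X b f x) p (\<lambda>_. 0)"

lemma capp_0: "capp X b (\<lambda>_. 0) = (\<lambda>_. 0)"
  by (auto simp: capp_def app_def zero_complex.code)

lemma capp_add: "capp X b (\<lambda>x. u x + v x) = (\<lambda>x. capp X b u x + capp X b v x)"
  using app_comb[of X b 1 _ 1] by (auto simp: capp_def fun_eq_iff complex_eq_iff)

lemma capp_scale: "capp X b (\<lambda>x. c * v x) = (\<lambda>x. c * capp X b v x)"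
proof -
  have "app X b (\<lambda>y. Re (c * v y)) = (\<lambda>x. Re c * app X b (\<lambda>y. Re (v y)) x + - Im c * app X b (\<lambda>y. Im (v y)) x)"
    by (subst app_comb[symmetric]) simp
  moreover have "app X b (\<lambda>y. Im (c * v y)) = (\<lambda>x. Re c * app X b (\<lambda>y. Im (v y)) x + Im c * app X b (\<lambda>y. Re (v y)) x)"
    by (subst app_comb[symmetric]) simp
  ultimately show ?thesis by (auto simp: capp_def complex_eq_iff)
qed

lemma peval_0 [simp]: "peval X b u 0 = (\<lambda>_. 0)"
  by (simp add: peval_def)

lemma peval_pCons: "peval X b u (pCons a p) = (\<lambda>x. a * u x + capp X b (peval X b u p) x)"
  by (cases "p = 0 \<and> a = 0") (auto simp: peval_def capp_0 fold_coeffs_pCons_not_0_0_eq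
      fold_coeffs_pCons_coeff_not_0_eq)

lemma peval_add: "peval X b u (p + q) = (\<lambda>x. peval X b u p x + peval X b u q x)"
  by (induction p q rule: poly_induct2) (auto simp: peval_pCons capp_add algebra_simps)

lemma peval_smult: "peval X b u (smult c p) = (\<lambda>x. c * peval X b u p x)"
  by (induction p) (auto simp: peval_pCons capp_scale algebra_simps)

lemma peval_linear_factor:
  "peval X b u ([:- z, 1:] * q) = (\<lambda>x. capp X b (peval X b u q) x - z * peval X b u q x)"
proof -
  have "[:- z, 1:] * q = smult (- z) q + pCons 0 q" by simp
  then show ?thesis by (simp only: peval_add peval_smult peval_pCons) auto
qed

lemma peval_monom: "peval X b u (monom c i) = (\<lambda>x. c * (capp X b ^^ i) u x)"
  by (induction i) (auto simp: peval_pCons monom_Suc capp_scale capp_0 monom_0)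

lemma peval_sum: "finite I \<Longrightarrow> peval X b u (\<Sum>i\<in>I. f i) = (\<lambda>x. \<Sum>i\<in>I. peval X b u (f i) x)"
  by (induction I rule: finite_induct) (auto simp: peval_add)

text \<open>Among the nonzero complex polynomials that annihilate some nonzero vector of the complexification of
\<open>S\<close>, take one of least degree and split off a root \<open>z\<close>. By minimality the cofactor does not
annihilate the vector, so it maps it to an eigenvector for \<open>z\<close>. Symmetry of the kernel, applied to
the real and the imaginary part of that eigenvector, forces \<open>z\<close> to be real.\<close>
lemma symmetric_eigenvector:
  assumes fin: "finite X" and S: "subspace_on X S" and inv: "\<And>v. v \<in> S \<Longrightarrow> app X b v \<in> S"
    and sym: "symmetric_kernel b" and v0: "v0 \<in> S" "v0 \<noteq> (\<lambda>_. 0)"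
  shows "\<exists>c. \<exists>v\<in>S. v \<noteq> (\<lambda>_. 0) \<and> app X b v = (\<lambda>x. c * v x)"
proof -
  define C where "C = {u :: 'a \<Rightarrow> complex. (\<lambda>x. Re (u x)) \<in> S \<and> (\<lambda>x. Im (u x)) \<in> S}"
  have C_capp: "capp X b u \<in> C" if "u \<in> C" for u
    using that inv by (auto simp: C_def capp_def)
  have C_comb: "(\<lambda>x. c * u x + w x) \<in> C" if "u \<in> C" "w \<in> C" for u w c
  proof -
    let ?r = "\<lambda>x. Re c * Re (u x) + - Im c * Im (u x)" and ?i = "\<lambda>x. Re c * Im (u x) + Im c * Re (u x)"
    have "?r \<in> S" "?i \<in> S" using that subspace_onD(3)[OF S] unfolding C_def by blast+
    then have "(\<lambda>x. 1 * ?r x + 1 * Re (w x)) \<in> S" "(\<lambda>x. 1 * ?i x + 1 * Im (w x)) \<in> S"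
      using that subspace_onD(3)[OF S] unfolding C_def by blast+
    then show ?thesis by (simp add: C_def algebra_simps)
  qed
  have C_peval: "peval X b u p \<in> C" if "u \<in> C" for u p
  proof (induction p)
    case 0
    show ?case using subspace_onD(2)[OF S] by (simp add: C_def)
  next
    case (pCons a p)
    then show ?case using C_comb C_capp that by (simp add: peval_pCons)
  qed
  define ann where "ann q \<longleftrightarrow> q \<noteq> 0 \<and> (\<exists>u\<in>C. u \<noteq> (\<lambda>_. 0) \<and> peval X b u q = (\<lambda>_. 0))" for q
  have "\<exists>q. ann q"
  proof -
    define w where "w i = (capp X b ^^ i) (\<lambda>x. complex_of_real (v0 x))" for i
    have wC: "w i \<in> C" and wr: "Im (w i x) = 0" for i x
    proof -
      have "w i \<in> C \<and> (\<forall>x. Im (w i x) = 0)"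
      proof (induction i)
        case 0
        show ?case using v0 subspace_onD(2)[OF S] by (simp add: w_def C_def)
      next
        case (Suc i)
        then show ?case using C_capp[of "w i"] by (auto simp: w_def capp_def app_def)
      qed
      then show "w i \<in> C" "Im (w i x) = 0" by auto
    qed
    \<comment> \<open>The \<open>card X + 1\<close> iterates of \<open>v0\<close> are linearly dependent.\<close>
    obtain c where c: "\<exists>i\<in>{..card X}. c i \<noteq> 0"
      "\<And>x. x \<in> X \<Longrightarrow> dot {..card X} (\<lambda>i. Re (w i x)) c = 0"
      using underdetermined_system[of "{..card X}" X "\<lambda>x i. Re (w i x)"] fin by auto
    define q where "q = (\<Sum>i\<le>card X. monom (complex_of_real (c i)) i)"
    from c(1) obtain k where k: "k \<le> card X" "c k \<noteq> 0" by auto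
    have "coeff q k = complex_of_real (c k)"
      using k(1) by (simp add: q_def coeff_sum coeff_monom)
    then have "q \<noteq> 0" using k by auto
    moreover have "peval X b (w 0) q x = 0" for x
    proof -
      have "peval X b (w 0) q x = (\<Sum>i\<le>card X. complex_of_real (c i) * w i x)"
        by (simp add: q_def peval_sum peval_monom w_def)
      also have "\<dots> = complex_of_real (dot {..card X} (\<lambda>i. Re (w i x)) c)"
        by (simp add: complex_eq_iff dot_def wr mult.commute)
      also have "\<dots> = 0"
      proof (cases "x \<in> X")
        case False
        have "Re (w i x) = 0" for i using wC[of i] subspace_onD(1)[OF S _ False]
          by (force simp: C_def)
        then show ?thesis by (simp add: dot_def)
      qed (simp add: c(2))
      finally show ?thesis .
    qed
    moreover have "w 0 \<noteq> (\<lambda>_. 0)" using v0(2) by (auto simp: w_def fun_eq_iff)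
    ultimately show ?thesis using wC unfolding ann_def by blast
  qed
  then obtain q where q: "ann q" and least: "\<And>q'. ann q' \<Longrightarrow> degree q \<le> degree q'"
    using ex_has_least_nat[of ann _ degree] by blast
  from q obtain u where u: "q \<noteq> 0" "u \<in> C" "u \<noteq> (\<lambda>_. 0)" "peval X b u q = (\<lambda>_. 0)"
    unfolding ann_def by blast
  have "degree q \<noteq> 0"
  proof
    assume "degree q = 0"
    then obtain a where a: "q = [:a:]" using degree_eq_zeroE by blast
    then have "peval X b u q = (\<lambda>x. a * u x)" by (simp add: peval_pCons capp_0)
    then show False using u a by (auto simp: fun_eq_iff)
  qed
  then have "\<not> constant (poly q)" by (simp add: constant_degree)
  then obtain z where "poly q z = 0" using fundamental_theorem_of_algebra by blast
  then obtain q' where q': "q = [:- z, 1:] * q'" using poly_eq_0_iff_dvd by blast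
  have "q' \<noteq> 0" using q' u(1) by auto
  then have "degree q' < degree q" unfolding q' by (subst degree_mult_eq) auto
  then have "\<not> ann q'" using least[of q'] by auto
  define w where "w = peval X b u q'"
  have w: "w \<in> C" "w \<noteq> (\<lambda>_. 0)"
    using \<open>\<not> ann q'\<close> \<open>q' \<noteq> 0\<close> u C_peval by (auto simp: ann_def w_def)
  have eig: "capp X b w = (\<lambda>x. z * w x)"
    using u(4) unfolding q' peval_linear_factor w_def by (simp add: fun_eq_iff)
  define p r where "p = (\<lambda>x. Re (w x))" and "r = (\<lambda>x. Im (w x))"
  have pS: "p \<in> S" "r \<in> S" using w by (auto simp: C_def p_def r_def)
  have ep: "app X b p = (\<lambda>x. Re z * p x + - Im z * r x)"
    and er: "app X b r = (\<lambda>x. Im z * p x + Re z * r x)"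
    using eig by (auto simp: capp_def fun_eq_iff complex_eq_iff p_def r_def)
  have "p \<noteq> (\<lambda>_. 0) \<or> r \<noteq> (\<lambda>_. 0)"
    using w(2) by (auto simp: p_def r_def fun_eq_iff complex_eq_iff)
  have "Im z = 0"
  proof -
    have "dot X p (app X b r) = dot X (app X b p) r" using app_symmetric[OF sym] .
    then have "Im z * (dot X p p + dot X r r) = 0"
      unfolding er ep dot_comb dot_comb_left by (simp add: algebra_simps)
    moreover have "dot X p p + dot X r r \<noteq> 0"
    proof
      assume "dot X p p + dot X r r = 0"
      then have "dot X p p = 0" "dot X r r = 0"
        using dot_self_nonneg[of X p] dot_self_nonneg[of X r] by linarith+
      then show False using \<open>p \<noteq> _ \<or> r \<noteq> _\<close> subspace_on_dot_self[OF S fin] pS by blast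
    qed
    ultimately show ?thesis by simp
  qed
  then show ?thesis using ep er pS \<open>p \<noteq> _ \<or> r \<noteq> _\<close> by auto
qed

text \<open>An eigenspace of one operator is invariant under the operators that commute with it, so the operators
can be diagonalised one after the other.\<close>
lemma joint_eigenvector:
  assumes fin: "finite X" "finite J" and sym: "\<And>j. j \<in> J \<Longrightarrow> symmetric_kernel (b j)"
    and S: "subspace_on X S" and inv: "\<And>j v. j \<in> J \<Longrightarrow> v \<in> S \<Longrightarrow> app X (b j) v \<in> S"
    and comm: "\<And>i j v. i \<in> J \<Longrightarrow> j \<in> J \<Longrightarrow> v \<in> S \<Longrightarrow>
        app X (b i) (app X (b j) v) = app X (b j) (app X (b i) v)"
    and v0: "v0 \<in> S" "v0 \<noteq> (\<lambda>_. 0)"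
  shows "\<exists>c. \<exists>v\<in>S. v \<noteq> (\<lambda>_. 0) \<and> (\<forall>j\<in>J. app X (b j) v = (\<lambda>x. c j * v x))"
  using fin(2) sym S inv comm v0
proof (induction J arbitrary: S v0 rule: finite_induct)
  case empty
  then show ?case by auto
next
  case (insert j J)
  obtain a v where v: "v \<in> S" "v \<noteq> (\<lambda>_. 0)" "app X (b j) v = (\<lambda>x. a * v x)"
    using symmetric_eigenvector[OF fin(1) insert.prems(2), of "b j" v0] insert.prems by auto
  define S' where "S' = {v \<in> S. app X (b j) v = (\<lambda>x. a * v x)}"
  have "subspace_on X S'"
    using insert.prems(2) unfolding subspace_on_def S'_def
    by (auto simp: app_comb algebra_simps) (simp add: app_def fun_eq_iff)
  moreover have "app X (b i) u \<in> S'" if "i \<in> J" "u \<in> S'" for i u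
  proof -
    have "app X (b j) (app X (b i) u) = app X (b i) (app X (b j) u)"
      using insert.prems(4)[of i j u] that by (auto simp: S'_def)
    also have "\<dots> = (\<lambda>x. a * app X (b i) u x)" using that by (simp add: S'_def app_scale)
    finally show ?thesis using insert.prems(3) that by (auto simp: S'_def)
  qed
  moreover have "v \<in> S'" using v by (simp add: S'_def)
  ultimately obtain c w where w: "w \<in> S'" "w \<noteq> (\<lambda>_. 0)" "\<forall>i\<in>J. app X (b i) w = (\<lambda>x. c i * w x)"
    using insert.IH[of S' v] insert.prems(1,4) v(2) by (auto simp: S'_def)
  have "\<forall>i\<in>insert j J. app X (b i) w = (\<lambda>x. (c(j := a)) i * w x)"
    using w insert.hyps by (auto simp: S'_def)
  moreover have "w \<in> S" using w by (simp add: S'_def)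
  ultimately show ?case using w(2) by blast
qed

section \<open>Exceptional joint eigenspaces of rational kernels\<close>

text \<open>The real numbers form a vector space over the rationals, in which \<open>a\<close> extends to a Hamel basis.\<close>
lemma rational_functional:
  fixes a :: real
  assumes "a \<noteq> 0"
  shows "\<exists>f :: real \<Rightarrow> rat. (\<forall>x y. f (x + y) = f x + f y) \<and> (\<forall>q x. f (of_rat q * x) = q * f x) \<and> f a \<noteq> 0"
proof -
  interpret vector_space_pair "\<lambda>q (x::real). of_rat q * x" "(*) :: rat \<Rightarrow> rat \<Rightarrow> rat"
    by unfold_locales (auto simp: algebra_simps of_rat_add of_rat_mult)
  have "vs1.independent {a}"
    using assms by simp
  from linear_independent_extend[OF this, of "\<lambda>_. 1"] obtain f where
    f: "Vector_Spaces.linear (\<lambda>q (x::real). of_rat q * x) ((*) :: rat \<Rightarrow> rat \<Rightarrow> rat) f" "f a = 1"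
    by auto
  then show ?thesis unfolding Vector_Spaces.linear_iff by (intro exI[of _ f]) simp
qed

lemma dot_rational:
  assumes "\<And>x. x \<in> X \<Longrightarrow> u x \<in> \<rat>" "\<And>x. x \<in> X \<Longrightarrow> v x \<in> \<rat>"
  shows "dot X u v \<in> \<rat>"
  unfolding dot_def using assms by (intro Rats_sum Rats_mult) auto

text \<open>As a function of \<open>t\<close> the scalar product is a nonzero polynomial. The vectors \<open>\<lambda>x. t ^ h x\<close> thus supply
rational vectors that avoid any finite number of given hyperplanes.\<close>
lemma power_vector_finite_zeros:
  assumes "finite X" "inj_on h X" "x0 \<in> X" "y x0 \<noteq> 0"
  shows "finite {t :: nat. dot X (\<lambda>x. real t ^ h x) y = 0}"
proof -
  define p where "p = (\<Sum>x\<in>X. monom (y x) (h x))"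
  have "coeff p (h x0) = (\<Sum>x\<in>X. if x = x0 then y x0 else 0)"
    using assms unfolding p_def coeff_sum by (intro sum.cong) (auto simp: inj_on_def)
  then have "p \<noteq> 0" using assms by auto
  then have "finite (real -` {t. poly p t = 0})"
    by (intro finite_vimageI poly_roots_finite inj_of_nat)
  moreover have "poly p (real t) = dot X (\<lambda>x. real t ^ h x) y" for t
    by (simp add: p_def poly_sum poly_monom dot_def mult.commute)
  ultimately show ?thesis by (simp add: vimage_def)
qed

text \<open>For a subspace \<open>S\<close> this says that its dimension is at most \<open>q\<close>: the functionals in \<open>G\<close> map \<open>S\<close>
injectively into a space of dimension \<open>card G\<close>.\<close>
definition separated :: "'a set \<Rightarrow> nat \<Rightarrow> ('a \<Rightarrow> real) set \<Rightarrow> bool" where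
  "separated X q S \<longleftrightarrow> (\<exists>G. finite G \<and> card G \<le> q \<and>
     (\<forall>y\<in>S. (\<forall>g\<in>G. dot X g y = 0) \<longrightarrow> y = (\<lambda>_. 0)))"

text \<open>A proper hyperplane section has smaller dimension. In terms of functionals: one functional \<open>g1\<close> that
does not vanish at \<open>y0\<close> is used up to make all others vanish at \<open>y0\<close>.\<close>
lemma separated_hyperplane:
  assumes S: "subspace_on X S" and sep: "separated X (Suc q) S"
    and y0: "y0 \<in> S" "dot X u y0 \<noteq> 0"
  shows "separated X q {y \<in> S. dot X u y = 0}"
proof -
  obtain G where G: "finite G" "card G \<le> Suc q"
    "\<And>y. y \<in> S \<Longrightarrow> (\<And>g. g \<in> G \<Longrightarrow> dot X g y = 0) \<Longrightarrow> y = (\<lambda>_. 0)"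
    using sep unfolding separated_def by blast
  have "y0 \<noteq> (\<lambda>_. 0)" using y0 by auto
  then obtain g1 where g1: "g1 \<in> G" "dot X g1 y0 \<noteq> 0" using G(3) y0 by blast
  define c where "c g = dot X g y0 / dot X g1 y0" for g
  define G' where "G' = (\<lambda>g x. 1 * g x + - c g * g1 x) ` (G - {g1})"
  have "card G' \<le> card (G - {g1})" using G(1) by (simp add: G'_def card_image_le)
  then have "card G' \<le> q" using G(1,2) g1(1) by simp
  moreover have "y = (\<lambda>_. 0)" if y: "y \<in> S" "dot X u y = 0" "\<forall>g\<in>G'. dot X g y = 0" for y
  proof -
    define a where "a = dot X g1 y / dot X g1 y0"
    have "dot X g (\<lambda>x. 1 * y x + - a * y0 x) = 0" if "g \<in> G" for g
    proof (cases "g = g1")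
      case True
      then show ?thesis unfolding dot_comb using g1 by (simp add: a_def)
    next
      case False
      then have "dot X (\<lambda>x. 1 * g x + - c g * g1 x) y = 0" using that y(3) by (auto simp: G'_def)
      then show ?thesis unfolding dot_comb dot_comb_left a_def c_def
        by (simp add: mult.commute)
    qed
    from G(3)[OF subspace_onD(3)[OF S y(1) y0(1)] this]
    have *: "(\<lambda>x. 1 * y x + - a * y0 x) = (\<lambda>_. 0)" by blast
    have "dot X u (\<lambda>x. 1 * y x + - a * y0 x) = 0" unfolding * by simp
    then have "a = 0" unfolding dot_comb using y(2) y0(2) by simp
    then show ?thesis using * by simp
  qed
  moreover have "finite G'" using G by (simp add: G'_def)
  ultimately show ?thesis unfolding separated_def by blast
qed

text \<open>Functionals separating subspaces of dimension at most \<open>q\<close> may be chosen rational and the same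
for finitely many subspaces: a power vector that does not vanish on any of the nonzero subspaces
lowers all the dimensions at once.\<close>
lemma common_rational_separation:
  assumes "finite X" "finite I" "\<And>i. i \<in> I \<Longrightarrow> subspace_on X (S i)" "\<And>i. i \<in> I \<Longrightarrow> separated X q (S i)"
  shows "\<exists>U. finite U \<and> card U \<le> q \<and> (\<forall>u\<in>U. \<forall>x\<in>X. u x \<in> \<rat>) \<and>
    (\<forall>i\<in>I. \<forall>y\<in>S i. (\<forall>u\<in>U. dot X u y = 0) \<longrightarrow> y = (\<lambda>_. 0))"
  using assms(3,4)
proof (induction q arbitrary: S)
  case 0
  have "y = (\<lambda>_. 0)" if i: "i \<in> I" and y: "y \<in> S i" for i y
    using 0(2)[OF i] y unfolding separated_def by auto
  then show ?case by (intro exI[of _ "{}"]) auto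
next
  case (Suc q)
  obtain h :: "'a \<Rightarrow> nat" where h: "inj_on h X"
    using assms(1) finite_imp_inj_to_nat_seg by blast
  define I' where "I' = {i \<in> I. S i \<noteq> {\<lambda>_. 0}}"
  have "\<exists>y. y \<in> S i \<and> (\<exists>x\<in>X. y x \<noteq> 0)" if "i \<in> I'" for i
  proof -
    from that Suc.prems have "subspace_on X (S i)" "S i \<noteq> {\<lambda>_. 0}" by (auto simp: I'_def)
    note sub = subspace_onD[OF this(1)]
    then obtain y where "y \<in> S i" "y \<noteq> (\<lambda>_. 0)" using \<open>S i \<noteq> _\<close> by blast
    then show ?thesis using sub(1) by (metis ext)
  qed
  then obtain y where y: "\<And>i. i \<in> I' \<Longrightarrow> y i \<in> S i" "\<And>i. i \<in> I' \<Longrightarrow> \<exists>x\<in>X. y i x \<noteq> 0" by metis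
  have "finite (\<Union>i\<in>I'. {t :: nat. dot X (\<lambda>x. real t ^ h x) (y i) = 0})"
  proof (intro finite_UN_I)
    show "finite I'" using assms(2) by (simp add: I'_def)
  qed (use y(2) power_vector_finite_zeros[OF assms(1) h] in blast)
  then obtain t :: nat where t: "t \<notin> (\<Union>i\<in>I'. {t. dot X (\<lambda>x. real t ^ h x) (y i) = 0})"
    using ex_new_if_finite infinite_UNIV_nat by blast
  define u where "u = (\<lambda>x. real t ^ h x)"
  define S' where "S' i = {z \<in> S i. dot X u z = 0}" for i
  have "subspace_on X (S' i)" if "i \<in> I" for i
    using Suc.prems(1)[OF that] unfolding subspace_on_def S'_def by (auto simp: dot_comb)
  moreover have "separated X q (S' i)" if "i \<in> I" for i
  proof (cases "i \<in> I'")
    case True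
    then show ?thesis
      using separated_hyperplane[OF Suc.prems(1,2), OF that that y(1), of u] t
      by (auto simp: S'_def u_def)
  next
    case False
    then have "S' i \<subseteq> {\<lambda>_. 0}" using that by (auto simp: S'_def I'_def)
    then show ?thesis unfolding separated_def by (intro exI[of _ "{}"]) auto
  qed
  ultimately obtain U where U: "finite U" "card U \<le> q" "\<forall>u\<in>U. \<forall>x\<in>X. u x \<in> \<rat>"
    "\<forall>i\<in>I. \<forall>y\<in>S' i. (\<forall>u\<in>U. dot X u y = 0) \<longrightarrow> y = (\<lambda>_. 0)"
    using Suc.IH[of S'] by blast
  show ?case
  proof (intro exI[of _ "insert u U"] conjI)
    show "card (insert u U) \<le> Suc q" using U by (simp add: card_insert_if)
    show "\<forall>u\<in>insert u U. \<forall>x\<in>X. u x \<in> \<rat>" using U by (auto simp: u_def)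
    show "finite (insert u U)" using U(1) by simp
    show "\<forall>i\<in>I. \<forall>y\<in>S i. (\<forall>u\<in>insert u U. dot X u y = 0) \<longrightarrow> y = (\<lambda>_. 0)"
      using U(4) unfolding S'_def by blast
  qed
qed

definition eigenspace :: "'a set \<Rightarrow> 'j set \<Rightarrow> ('j \<Rightarrow> 'a \<Rightarrow> 'a \<Rightarrow> real) \<Rightarrow> ('a \<Rightarrow> real) \<Rightarrow> ('j \<Rightarrow> real) \<Rightarrow> ('a \<Rightarrow> real) set" where
  "eigenspace X J b c \<theta> = {v. (\<forall>x. x \<notin> X \<longrightarrow> v x = 0) \<and> dot X c v = 0 \<and>
     (\<forall>j\<in>J. app X (b j) v = (\<lambda>x. \<theta> j * v x))}"

lemma subspace_on_eigenspace: "subspace_on X (eigenspace X J b c \<theta>)"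
  unfolding subspace_on_def eigenspace_def
  by (auto simp: app_comb dot_comb algebra_simps) (simp add: app_def fun_eq_iff)

lemma eigenspaces_orthogonal:
  assumes "u \<in> eigenspace X J b c \<theta>" "v \<in> eigenspace X J b c \<psi>" "j \<in> J" "symmetric_kernel (b j)" "\<theta> j \<noteq> \<psi> j"
  shows "dot X u v = 0"
proof -
  have "dot X u (app X (b j) v) = dot X (app X (b j) u) v" using assms by (intro app_symmetric)
  moreover have "app X (b j) v = (\<lambda>x. \<psi> j * v x + 0 * v x)" "app X (b j) u = (\<lambda>x. \<theta> j * u x + 0 * u x)"
    using assms by (auto simp: eigenspace_def)
  ultimately have "\<psi> j * dot X u v = \<theta> j * dot X u v" by (simp only: dot_comb dot_comb_left)
  then show ?thesis using assms(5) by auto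
qed

text \<open>Eigenvectors for distinct joint eigenvalues are orthogonal, hence independent, so there are at most
\<open>card X\<close> of them.\<close>
lemma finite_joint_spectrum:
  assumes fin: "finite X" and sym: "\<And>j. j \<in> J \<Longrightarrow> symmetric_kernel (b j)"
  shows "finite {\<theta> \<in> extensional J. eigenspace X J b c \<theta> \<noteq> {\<lambda>_. 0}}" (is "finite ?Q")
proof (rule ccontr)
  assume "infinite ?Q"
  then obtain Q where Q: "Q \<subseteq> ?Q" "finite Q" "card Q = Suc (card X)"
    by (meson infinite_arbitrarily_large)
  have "\<exists>v. v \<in> eigenspace X J b c \<theta> \<and> v \<noteq> (\<lambda>_. 0)" if "\<theta> \<in> Q" for \<theta>
    using that Q(1) subspace_onD(2)[OF subspace_on_eigenspace, of X J b c \<theta>] by blast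
  then obtain e where e: "\<And>\<theta>. \<theta> \<in> Q \<Longrightarrow> e \<theta> \<in> eigenspace X J b c \<theta>" "\<And>\<theta>. \<theta> \<in> Q \<Longrightarrow> e \<theta> \<noteq> (\<lambda>_. 0)"
    by metis
  obtain a where a: "\<exists>\<theta>\<in>Q. a \<theta> \<noteq> 0" "\<And>x. x \<in> X \<Longrightarrow> dot Q (\<lambda>\<theta>. e \<theta> x) a = 0"
    using underdetermined_system[of Q X "\<lambda>x \<theta>. e \<theta> x"] Q fin by auto
  from a(1) obtain \<psi> where \<psi>: "\<psi> \<in> Q" "a \<psi> \<noteq> 0" by blast
  have orth: "dot X (e \<psi>) (e \<theta>) = 0" if "\<theta> \<in> Q" "\<theta> \<noteq> \<psi>" for \<theta>
  proof -
    have "\<theta> \<in> extensional J" "\<psi> \<in> extensional J" using that \<psi> Q by auto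
    with that(2) obtain j where "j \<in> J" "\<psi> j \<noteq> \<theta> j" by (metis extensionalityI)
    then show ?thesis using eigenspaces_orthogonal[OF e(1)[OF \<psi>(1)] e(1)[OF that(1)]] sym by blast
  qed
  have "0 = dot X (e \<psi>) (\<lambda>x. dot Q (\<lambda>\<theta>. e \<theta> x) a)"
    using a(2) by (simp add: dot_def)
  also have "\<dots> = (\<Sum>\<theta>\<in>Q. a \<theta> * dot X (e \<psi>) (e \<theta>))"
    unfolding dot_def sum_distrib_left by (subst sum.swap) (simp add: mult_ac)
  also have "\<dots> = a \<psi> * dot X (e \<psi>) (e \<psi>)"
    using Q(2) \<psi>(1) orth by (subst sum.remove[of _ \<psi>]) auto
  finally show False
    using \<psi> e subspace_on_dot_self[OF subspace_on_eigenspace fin] by (metis mult_eq_0_iff)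
qed

lemma app_rational:
  assumes "\<And>x y. x \<in> X \<Longrightarrow> y \<in> X \<Longrightarrow> b x y \<in> \<rat>" "\<And>x. x \<in> X \<Longrightarrow> v x \<in> \<rat>"
  shows "app X b v x \<in> \<rat>"
  using assms by (auto simp: app_def intro!: dot_rational)

text \<open>Rational linear relations survive the entrywise application of a functional that is linear over the
rationals, and such a functional with rational values turns \<open>w\<close> into a rational vector.\<close>
lemma nonzero_rational_in_hull:
  assumes fin: "finite X" and x0: "w x0 \<noteq> 0" and supp: "\<And>x. x \<notin> X \<Longrightarrow> w x = 0"
  shows "\<exists>y. (\<forall>x. y x \<in> \<rat>) \<and> y x0 \<noteq> 0 \<and> (\<forall>x. x \<notin> X \<longrightarrow> y x = 0) \<and>
    (\<forall>r. (\<forall>x\<in>X. r x \<in> \<rat>) \<longrightarrow> dot X r w = 0 \<longrightarrow> dot X r y = 0)"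
proof -
  obtain f :: "real \<Rightarrow> rat" where f: "\<And>x y. f (x + y) = f x + f y"
    "\<And>q x. f (of_rat q * x) = q * f x" "f (w x0) \<noteq> 0"
    using rational_functional[OF x0] by blast
  have f0: "f 0 = 0" using f(1)[of 0 0] by simp
  define y where "y x = real_of_rat (f (w x))" for x
  have "dot X r y = 0" if r: "\<forall>x\<in>X. r x \<in> \<rat>" "dot X r w = 0" for r
  proof -
    have sum: "f (sum g A) = (\<Sum>x\<in>A. f (g x))" if "finite A" for g and A :: "'a set"
      using that by (induction A rule: finite_induct) (auto simp: f f0)
    have "dot X r y = real_of_rat (f (dot X r w))"
      unfolding dot_def sum[OF fin] of_rat_sum
    proof (intro sum.cong refl)
      fix x assume "x \<in> X"
      then obtain q where "r x = of_rat q" using r(1) Rats_cases by metis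
      then show "r x * y x = real_of_rat (f (r x * w x))"
        by (simp add: f(2) y_def of_rat_mult)
    qed
    then show ?thesis using r(2) f0 by simp
  qed
  then show ?thesis using f(3) f0 supp by (intro exI[of _ y]) (auto simp: y_def)
qed

text \<open>Choose rational vectors \<open>U\<close>, at most \<open>q\<close> of them, that separate all joint eigenspaces other than
that of \<open>\<kappa>\<close>, and a nonzero \<open>w\<close> in the latter that is orthogonal to \<open>U\<close>. Let \<open>Y\<close> be the rational hull
of \<open>w\<close>, that is, the vectors that satisfy all rational linear relations of \<open>w\<close>. Since the kernels are
rational and \<open>w\<close> is a joint eigenvector, \<open>Y\<close> is invariant, the operators commute on \<open>Y\<close>, and \<open>Y\<close> is
orthogonal to \<open>U\<close>. A joint eigenvector in \<open>Y\<close> orthogonal to the eigenspace of \<open>\<kappa>\<close> would belong to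
another eigenvalue and be killed by \<open>U\<close>, which is impossible. So \<open>Y\<close> lies in the eigenspace of
\<open>\<kappa>\<close>, and a nonzero rational vector of \<open>Y\<close> exhibits \<open>\<kappa> j\<close> as a quotient of rationals.\<close>
theorem exceptional_eigenvalue_rational:
  fixes b :: "'j \<Rightarrow> 'a \<Rightarrow> 'a \<Rightarrow> real" and c :: "'a \<Rightarrow> real"
  assumes fin: "finite X" "finite J" and sym: "\<And>j. j \<in> J \<Longrightarrow> symmetric_kernel (b j)"
    and rat: "\<And>j x y. j \<in> J \<Longrightarrow> x \<in> X \<Longrightarrow> y \<in> X \<Longrightarrow> b j x y \<in> \<rat>" "\<And>x. x \<in> X \<Longrightarrow> c x \<in> \<rat>"
    and big: "\<not> separated X q (eigenspace X J b c \<kappa>)"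
    and small: "\<And>\<theta>. \<exists>j\<in>J. \<theta> j \<noteq> \<kappa> j \<Longrightarrow> separated X q (eigenspace X J b c \<theta>)"
    and j: "j \<in> J"
  shows "\<kappa> j \<in> \<rat>"
proof -
  let ?E = "eigenspace X J b c"
  define Q where "Q = {\<theta> \<in> extensional J. ?E \<theta> \<noteq> {\<lambda>_. 0} \<and> (\<exists>j\<in>J. \<theta> j \<noteq> \<kappa> j)}"
  have "finite Q"
    by (rule finite_subset[OF _ finite_joint_spectrum[OF fin(1) sym, where c = c]]) (auto simp: Q_def)
  moreover have "separated X q (?E \<theta>)" if "\<theta> \<in> Q" for \<theta>
    using that by (intro small) (simp add: Q_def)
  ultimately obtain U where U: "finite U" "card U \<le> q" "\<And>u x. u \<in> U \<Longrightarrow> x \<in> X \<Longrightarrow> u x \<in> \<rat>"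
    "\<And>\<theta> y. \<theta> \<in> Q \<Longrightarrow> y \<in> ?E \<theta> \<Longrightarrow> \<forall>u\<in>U. dot X u y = 0 \<Longrightarrow> y = (\<lambda>_. 0)"
    using common_rational_separation[OF fin(1), of Q ?E q] subspace_on_eigenspace by metis
  obtain w where w: "w \<in> ?E \<kappa>" "\<And>u. u \<in> U \<Longrightarrow> dot X u w = 0" "w \<noteq> (\<lambda>_. 0)"
    using big U(1,2) unfolding separated_def by blast
  have w_app: "app X (b i) w = (\<lambda>x. \<kappa> i * w x)" if "i \<in> J" for i
    using w(1) that by (auto simp: eigenspace_def)
  define Y where "Y = {v. (\<forall>x. x \<notin> X \<longrightarrow> v x = 0) \<and>
    (\<forall>r. (\<forall>x\<in>X. r x \<in> \<rat>) \<longrightarrow> dot X r w = 0 \<longrightarrow> dot X r v = 0)}"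
  have Y_D: "dot X r v = 0" if "v \<in> Y" "\<And>x. x \<in> X \<Longrightarrow> r x \<in> \<rat>" "dot X r w = 0" for v r
    using that by (auto simp: Y_def)
  have Y_sub: "subspace_on X Y" by (auto simp: subspace_on_def Y_def dot_comb)
  have Y_app: "app X (b i) v \<in> Y" if "i \<in> J" "v \<in> Y" for i v
  proof -
    have "dot X r (app X (b i) v) = 0" if r: "\<forall>x\<in>X. r x \<in> \<rat>" "dot X r w = 0" for r
    proof -
      have "dot X (app X (b i) r) w = dot X r (\<lambda>x. \<kappa> i * w x + 0 * w x)"
        using app_symmetric[OF sym[OF \<open>i \<in> J\<close>], of X r w] w_app[OF \<open>i \<in> J\<close>] by simp
      also have "\<dots> = 0" unfolding dot_comb using r(2) by simp
      finally have "dot X (app X (b i) r) v = 0"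
        using r rat \<open>i \<in> J\<close> by (intro Y_D[OF \<open>v \<in> Y\<close>]) (auto intro!: app_rational)
      then show ?thesis using app_symmetric[OF sym[OF \<open>i \<in> J\<close>], of X r v] by simp
    qed
    then show ?thesis by (auto simp: Y_def app_def)
  qed
  have Y_comm: "app X (b i) (app X (b k) v) = app X (b k) (app X (b i) v)"
    if ik: "i \<in> J" "k \<in> J" and v: "v \<in> Y" for i k v
  proof (rule ext)
    fix x
    show "app X (b i) (app X (b k) v) x = app X (b k) (app X (b i) v) x"
    proof (cases "x \<in> X")
      case True
      define d :: "'a \<Rightarrow> real" where "d z = of_bool (z = x)" for z
      have d: "dot X d f = f x" for f
        using fin(1) True by (simp add: dot_def d_def)
      \<comment> \<open>Row \<open>x\<close> of the commutator is a rational relation of \<open>w\<close>.\<close>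
      define r where "r z = 1 * app X (b k) (app X (b i) d) z + - 1 * app X (b i) (app X (b k) d) z" for z
      have r: "dot X r f = app X (b i) (app X (b k) f) x - app X (b k) (app X (b i) f) x" for f
        unfolding r_def dot_comb_left
        by (simp add: app_symmetric[OF sym, OF ik(1), symmetric] app_symmetric[OF sym, OF ik(2), symmetric] d)
      have "dot X r v = 0"
      proof (rule Y_D[OF v])
        show "r z \<in> \<rat>" if "z \<in> X" for z
          using ik rat unfolding r_def
          by (intro Rats_add Rats_mult app_rational) (auto simp: d_def of_bool_def)
        show "dot X r w = 0" by (simp add: r w_app[OF ik(1)] w_app[OF ik(2)] app_scale mult_ac)
      qed
      then show ?thesis by (simp add: r)
    qed (simp add: app_def)
  qed
  define S where "S = {v \<in> Y. \<forall>e\<in>?E \<kappa>. dot X e v = 0}"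
  have S_sub: "subspace_on X S"
    using Y_sub by (auto simp: subspace_on_def S_def dot_comb)
  have E_app: "app X (b i) e \<in> ?E \<kappa>" if "i \<in> J" "e \<in> ?E \<kappa>" for i e
  proof -
    have "app X (b i) e = (\<lambda>x. \<kappa> i * e x)" using that by (simp add: eigenspace_def)
    then show ?thesis using subspace_onD(4)[OF subspace_on_eigenspace that(2)] by metis
  qed
  \<comment> \<open>No joint eigenvector fits into the part of the hull orthogonal to the eigenspace of \<open>\<kappa>\<close>.\<close>
  have S_trivial: "v = (\<lambda>_. 0)" if "v \<in> S" for v
  proof (rule ccontr)
    assume "v \<noteq> (\<lambda>_. 0)"
    moreover have "app X (b i) v \<in> S" if "i \<in> J" "v \<in> S" for i v
      using that E_app Y_app by (auto simp: S_def app_symmetric[OF sym])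
    moreover have "app X (b i) (app X (b k) v) = app X (b k) (app X (b i) v)"
      if "i \<in> J" "k \<in> J" "v \<in> S" for i k v
      using Y_comm that by (simp add: S_def)
    ultimately obtain \<theta> y where y: "y \<in> S" "y \<noteq> (\<lambda>_. 0)"
      "\<And>i. i \<in> J \<Longrightarrow> app X (b i) y = (\<lambda>x. \<theta> i * y x)"
      using joint_eigenvector[where b = b, OF fin sym S_sub, where ?v0.0 = v] \<open>v \<in> S\<close> by blast
    have "y \<in> Y" using y by (simp add: S_def)
    have "dot X c y = 0"
      using w(1) rat(2) by (intro Y_D[OF \<open>y \<in> Y\<close>]) (auto simp: eigenspace_def)
    then have yE: "y \<in> ?E (restrict \<theta> J)"
      using y(3) subspace_onD(1)[OF Y_sub \<open>y \<in> Y\<close>] by (auto simp: eigenspace_def)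
    show False
    proof (cases "\<exists>i\<in>J. \<theta> i \<noteq> \<kappa> i")
      case True
      then have "restrict \<theta> J \<in> Q" using yE y(2) by (auto simp: Q_def)
      from U(4)[OF this yE] show False using y(2) U(3) w(2) Y_D[OF \<open>y \<in> Y\<close>] by blast
    next
      case False
      then have "y \<in> ?E \<kappa>" using yE by (auto simp: eigenspace_def)
      then have "dot X y y = 0" using y(1) by (auto simp: S_def)
      then show False using subspace_on_dot_self[OF S_sub fin(1) y(1)] y(2) by blast
    qed
  qed
  have Y_eigen: "app X (b j) y = (\<lambda>x. \<kappa> j * y x)" if "y \<in> Y" for y
  proof -
    let ?z = "\<lambda>x. 1 * app X (b j) y x + - \<kappa> j * y x"
    have "?z \<in> Y" using subspace_onD(3)[OF Y_sub Y_app[OF j that] that] .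
    moreover have "dot X e ?z = 0" if e: "e \<in> ?E \<kappa>" for e
    proof -
      have *: "app X (b j) e = (\<lambda>x. \<kappa> j * e x + 0 * e x)" using e j by (simp add: eigenspace_def)
      show ?thesis unfolding dot_comb app_symmetric[OF sym[OF j]] * dot_comb_left by simp
    qed
    ultimately have "?z = (\<lambda>_. 0)" by (intro S_trivial) (auto simp: S_def)
    then show ?thesis by (simp add: fun_eq_iff)
  qed
  obtain x0 where x0: "w x0 \<noteq> 0" using w(3) by blast
  have supp: "w x = 0" if "x \<notin> X" for x using w(1) that by (auto simp: eigenspace_def)
  obtain y where y: "\<And>x. y x \<in> \<rat>" "y x0 \<noteq> 0" "y \<in> Y"
    using nonzero_rational_in_hull[where w = w, OF fin(1) x0 supp] unfolding Y_def by blast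
  have "\<kappa> j = app X (b j) y x0 / y x0" using y(2) Y_eigen[OF y(3)] by simp
  moreover have "app X (b j) y x0 \<in> \<rat>" using rat j y(1) by (intro app_rational) auto
  ultimately show ?thesis using y(1) by simp
qed

text \<open>Replace the eigenvector by a rational one, clear denominators, and let \<open>k = p / q\<close> in lowest terms.
Then \<open>q\<close> times an integer vector equals \<open>p\<close> times the eigenvector, so \<open>q\<close> divides all its entries.
The quotient is again an integer eigenvector, and repeating this shows that all powers of \<open>q\<close> divide a
nonzero integer.\<close>
lemma integer_eigenvalue:
  assumes fin: "finite X" and int: "\<And>x y. x \<in> X \<Longrightarrow> y \<in> X \<Longrightarrow> b x y \<in> \<int>" and k: "k \<in> \<rat>"
    and w: "x0 \<in> X" "w x0 \<noteq> 0" "\<And>x. x \<in> X \<Longrightarrow> dot X (b x) w = k * w x"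
  shows "k \<in> \<int>"
proof -
  define w' where "w' x = (if x \<in> X then w x else 0)" for x
  have "w' x0 \<noteq> 0" using w by (simp add: w'_def)
  then obtain y where y: "\<And>x. y x \<in> \<rat>" "y x0 \<noteq> 0"
    "\<forall>r. (\<forall>x\<in>X. r x \<in> \<rat>) \<longrightarrow> dot X r w' = 0 \<longrightarrow> dot X r y = 0"
    using nonzero_rational_in_hull[OF fin, of w' x0] w'_def by auto
  have y_eig: "dot X (b x) y = k * y x" if x: "x \<in> X" for x
  proof -
    define d :: "'a \<Rightarrow> real" where "d z = of_bool (z = x)" for z
    have d: "dot X d f = f x" for f using fin x by (simp add: dot_def d_def)
    have "dot X (\<lambda>z. 1 * b x z + - k * d z) y = 0"
    proof (rule y(3)[rule_format])
      show "1 * b x z + - k * d z \<in> \<rat>" if "z \<in> X" for z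
        using int[OF x that] k Ints_subset_Rats by (auto simp: d_def of_bool_def)
      have "dot X (b x) w' = dot X (b x) w" by (auto simp: dot_def w'_def intro!: sum.cong)
      then show "dot X (\<lambda>z. 1 * b x z + - k * d z) w' = 0"
        unfolding dot_comb_left d using w(3)[OF x] x by (simp add: w'_def)
    qed
    then show ?thesis unfolding dot_comb_left d by simp
  qed
  obtain p q :: int where pq: "q > 0" "coprime p q" "k = of_int p / of_int q"
    using k Rats_cases' by blast
  obtain D :: int where D: "D > 0" "\<And>x. x \<in> X \<Longrightarrow> of_int D * y x \<in> \<int>"
  proof -
    have "\<exists>D::int. D > 0 \<and> (\<forall>x\<in>A. of_int D * y x \<in> \<int>)" if "finite A" for A
      using that
    proof (induction A rule: finite_induct)
      case empty
      show ?case by (intro exI[of _ 1]) auto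
    next
      case (insert a A)
      then obtain D :: int where D: "D > 0" "\<forall>x\<in>A. of_int D * y x \<in> \<int>" by blast
      obtain m n :: int where mn: "n > 0" "y a = of_int m / of_int n"
        using y(1)[of a] Rats_cases' by metis
      have "of_int (n * D) * y x \<in> \<int>" if "x \<in> insert a A" for x
      proof (cases "x = a")
        case True
        then have "of_int (n * D) * y x = of_int (D * m)" using mn by simp
        then show ?thesis by (metis Ints_of_int)
      next
        case False
        then have "of_int D * y x \<in> \<int>" using D(2) that by blast
        then have "of_int n * (of_int D * y x) \<in> \<int>" by (rule Ints_mult[OF Ints_of_int])
        then show ?thesis by (simp add: mult_ac)
      qed
      then show ?case using D(1) mn(1) by (intro exI[of _ "n * D"]) auto
    qed
    then show ?thesis using that fin by blast
  qed
  have desc: "of_int D * y x / of_int q ^ m \<in> \<int>" if "x \<in> X" for x m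
    using that
  proof (induction m arbitrary: x)
    case 0
    then show ?case using D(2) by simp
  next
    case (Suc m)
    define z where "z x = of_int D * y x / of_int q ^ m" for x
    have zi: "z x \<in> \<int>" if "x \<in> X" for x using Suc.IH that by (simp add: z_def)
    have "of_int q * dot X (b x) z = of_int p * z x"
    proof -
      have "dot X (b x) z = of_int D / of_int q ^ m * dot X (b x) y"
        by (simp add: dot_def z_def sum_distrib_left mult_ac)
      then show ?thesis using y_eig[OF Suc.prems] pq(1,3) by (simp add: z_def)
    qed
    moreover obtain i where i: "dot X (b x) z = of_int i"
      using zi int[OF Suc.prems] unfolding dot_def by (metis (no_types, lifting) Ints_cases Ints_mult Ints_sum)
    moreover obtain l where l: "z x = of_int l" using zi[OF Suc.prems] Ints_cases by blast
    ultimately have "of_int (q * i) = (of_int (p * l) :: real)" by simp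
    then have "q * i = p * l" by (simp only: of_int_eq_iff)
    then have "q dvd l" using pq(2) by (metis coprime_commute coprime_dvd_mult_right_iff dvd_triv_left)
    then obtain l' where "l = q * l'" by blast
    then have "of_int D * y x / of_int q ^ Suc m = of_int l'"
      using l pq(1) by (simp add: z_def field_simps)
    then show ?case by (metis Ints_of_int)
  qed
  have "q = 1"
  proof (rule ccontr)
    assume "q \<noteq> 1"
    then have q2: "q \<ge> 2" using pq(1) by simp
    define a where "a = \<bar>of_int D * y x0\<bar>"
    have "a > 0" using D(1) y(2) by (simp add: a_def)
    obtain m :: nat where m: "a < 2 ^ m" using real_arch_pow[of 2 a] by auto
    have "a / of_int q ^ m \<ge> 1"
    proof -
      have "of_int D * y x0 / of_int q ^ m \<noteq> 0" using D(1) y(2) pq(1) by simp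
      then have "1 \<le> \<bar>of_int D * y x0 / of_int q ^ m\<bar>"
        using Ints_nonzero_abs_ge1[OF desc[OF w(1)]] by blast
      then show ?thesis using pq(1) by (simp add: a_def abs_mult)
    qed
    then have "of_int q ^ m \<le> a" using pq(1) by simp
    moreover have "(2::real) ^ m \<le> of_int q ^ m" using q2 by (intro power_mono) auto
    ultimately show False using m by simp
  qed
  then show ?thesis using pq by simp
qed

section \<open>Moments of a vector and powers of the distance\<close>

text \<open>Monomials are indexed by multisets of coordinates, which makes their number available from the
enumeration of multisets. Products of scalar products expand into sums over words, that is, over lists
of coordinates; a word contributes the monomial of its multiset.\<close>
definition mon :: "'n multiset \<Rightarrow> real ^ 'n \<Rightarrow> real" where
  "mon M x = (\<Prod>i\<in>#M. x $ i)"

lemma mon_empty [simp]: "mon {#} x = 1" by (simp add: mon_def)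
lemma mon_add: "mon (M + M') x = mon M x * mon M' x" by (simp add: mon_def)
lemma mon_add_mset: "mon (add_mset i M) x = x $ i * mon M x" by (simp add: mon_def)

definition words :: "nat \<Rightarrow> 'n::finite list set" where
  "words c = {w. length w = c}"

lemma finite_words: "finite (words c :: 'n::finite list set)"
  using finite_lists_length_eq[of "UNIV :: 'n set" c] by (simp add: words_def)

lemma words_0: "words 0 = {[]}" by (auto simp: words_def)

lemma words_Suc: "words (Suc c) = (\<lambda>(i, w). i # w) ` (UNIV \<times> words c)"
  by (auto simp: words_def length_Suc_conv image_iff)

lemma inner_power_expand:
  fixes x y :: "real ^ 'n::finite"
  shows "(x \<bullet> y) ^ c = (\<Sum>w\<in>words c. mon (mset w) x * mon (mset w) y)"
proof (induction c)
  case 0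
  show ?case by (simp add: words_0)
next
  case (Suc c)
  have "(\<Sum>w\<in>words (Suc c). mon (mset w) x * mon (mset w) y)
      = (\<Sum>(i, w)\<in>UNIV \<times> words c. mon (mset (i # w)) x * mon (mset (i # w)) y)"
    unfolding words_Suc by (subst sum.reindex) (auto simp: inj_on_def intro!: sum.cong)
  also have "\<dots> = (\<Sum>i\<in>UNIV. \<Sum>w\<in>words c. (x $ i * y $ i) * (mon (mset w) x * mon (mset w) y))"
    by (simp add: sum.cartesian_product mon_add_mset mult_ac)
  also have "\<dots> = (\<Sum>i\<in>UNIV. x $ i * y $ i) * (\<Sum>w\<in>words c. mon (mset w) x * mon (mset w) y)"
    by (simp only: sum_product)
  also have "\<dots> = (x \<bullet> y) * (x \<bullet> y) ^ c"
    by (simp only: Suc) (simp add: inner_vec_def)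
  finally show ?case by simp
qed

lemma norm_power_expand:
  fixes x :: "real ^ 'n::finite"
  shows "(x \<bullet> x) ^ b * mon M x = (\<Sum>w\<in>words b. mon (mset w + mset w + M) x)"
  by (simp add: inner_power_expand sum_distrib_right mon_add)

definition moment :: "(real ^ 'n::finite) set \<Rightarrow> nat \<Rightarrow> 'n multiset \<Rightarrow> (real ^ 'n \<Rightarrow> real) \<Rightarrow> real" where
  "moment X a M v = dot X (\<lambda>x. (x \<bullet> x) ^ a * mon M x) v"

text \<open>The vectors that are orthogonal to all polynomials of degree less than \<open>l\<close>.\<close>
definition annihilates_below :: "(real ^ 'n::finite) set \<Rightarrow> nat \<Rightarrow> (real ^ 'n \<Rightarrow> real) \<Rightarrow> bool" where
  "annihilates_below X l v \<longleftrightarrow> (\<forall>M. size M < l \<longrightarrow> dot X (mon M) v = 0)"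

lemma moment_split:
  fixes X :: "(real ^ 'n::finite) set"
  shows "moment X (a + b) M v = (\<Sum>w\<in>words b. moment X a (mset w + mset w + M) v)"
proof -
  have "(x \<bullet> x) ^ (a + b) * mon M x = (\<Sum>w\<in>words b. (x \<bullet> x) ^ a * mon (mset w + mset w + M) x)" for x :: "real ^ 'n"
    by (simp only: power_add mult.assoc norm_power_expand[where b = b and M = M] sum_distrib_left)
  then have "moment X (a + b) M v = (\<Sum>x\<in>X. \<Sum>w\<in>words b. (x \<bullet> x) ^ a * mon (mset w + mset w + M) x * v x)"
    by (simp only: moment_def dot_def sum_distrib_right)
  then show ?thesis unfolding moment_def dot_def by (subst (asm) sum.swap)
qed

lemma moment_0: "moment X 0 M v = dot X (mon M) v"
  by (simp add: moment_def)

lemma moment_vanishes: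
  assumes "annihilates_below X l v" "2 * a + size M < l"
  shows "moment X a M v = 0"
  using moment_split[of X 0 a M v] assms by (simp add: moment_0 annihilates_below_def words_def)

text \<open>From \<open>\<bar>x - y\<bar>\<^sup>2 = \<bar>x\<bar>\<^sup>2 + \<bar>y\<bar>\<^sup>2 - 2 (x \<bullet> y)\<close>. The summand has degree \<open>2a + (l - k)\<close> in \<open>x\<close> and
\<open>2(k - a) + (l - k)\<close> in \<open>y\<close>, which add up to \<open>2l\<close>.\<close>
lemma distance_power_expand:
  fixes x y :: "real ^ 'n::finite"
  shows "((norm (x - y))\<^sup>2) ^ l = (\<Sum>k\<le>l. \<Sum>a\<le>k. real (l choose k) * real (k choose a) * (- 2) ^ (l - k) *
    (\<Sum>w\<in>words (l - k). ((x \<bullet> x) ^ a * mon (mset w) x) * ((y \<bullet> y) ^ (k - a) * mon (mset w) y)))"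
proof -
  have "(norm (x - y))\<^sup>2 = (x \<bullet> x + y \<bullet> y) + (- 2) * (x \<bullet> y)"
    by (simp add: power2_norm_eq_inner algebra_simps inner_commute)
  then have "((norm (x - y))\<^sup>2) ^ l = (\<Sum>k\<le>l. real (l choose k) * (x \<bullet> x + y \<bullet> y) ^ k * ((- 2) ^ (l - k) * (x \<bullet> y) ^ (l - k)))"
    by (simp only: binomial_ring power_mult_distrib)
  also have "\<dots> = (\<Sum>k\<le>l. \<Sum>a\<le>k. real (l choose k) * real (k choose a) * (- 2) ^ (l - k) *
      ((x \<bullet> x) ^ a * (y \<bullet> y) ^ (k - a) * (x \<bullet> y) ^ (l - k)))"
    by (simp only: binomial_ring[of "x \<bullet> x"] sum_distrib_left sum_distrib_right mult_ac)
  finally show ?thesis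
    by (simp only: inner_power_expand[of x y] sum_distrib_left mult_ac)
qed

lemma distance_power_row:
  fixes x :: "real ^ 'n::finite"
  shows "dot X (\<lambda>y. ((norm (x - y))\<^sup>2) ^ l) v =
    (\<Sum>k\<le>l. \<Sum>a\<le>k. real (l choose k) * real (k choose a) * (- 2) ^ (l - k) *
      (\<Sum>w\<in>words (l - k). ((x \<bullet> x) ^ a * mon (mset w) x) * moment X (k - a) (mset w) v))"
proof -
  have swap: "dot X (\<lambda>y. \<Sum>i\<in>I. f i y) v = (\<Sum>i\<in>I. dot X (f i) v)"
    for I :: "'i set" and f
    unfolding dot_def sum_distrib_right by (rule sum.swap)
  have scale: "dot X (\<lambda>y. c * f y) v = c * dot X f v" for c f
    by (simp add: dot_def sum_distrib_left mult_ac)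
  show ?thesis
    unfolding distance_power_expand swap scale moment_def ..
qed

definition distance_form :: "(real ^ 'n::finite) set \<Rightarrow> nat \<Rightarrow> (real ^ 'n \<Rightarrow> real) \<Rightarrow> real" where
  "distance_form X l v = (\<Sum>x\<in>X. v x * dot X (\<lambda>y. ((norm (x - y))\<^sup>2) ^ l) v)"

lemma distance_form_expand:
  "distance_form X l v = (\<Sum>k\<le>l. \<Sum>a\<le>k. real (l choose k) * real (k choose a) * (- 2) ^ (l - k) *
      (\<Sum>w\<in>words (l - k). moment X a (mset w) v * moment X (k - a) (mset w) v))"
proof -
  have swap: "dot X v (\<lambda>y. \<Sum>i\<in>I. f i y) = (\<Sum>i\<in>I. dot X v (f i))"
    for I :: "'i set" and f
    unfolding dot_def sum_distrib_left by (rule sum.swap)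
  have scale: "dot X v (\<lambda>y. c * f y) = c * dot X v f" for c f
    by (simp add: dot_def sum_distrib_left mult_ac)
  have scale': "dot X v (\<lambda>y. f y * c) = dot X v f * c" for c f
    by (simp add: dot_def sum_distrib_left mult_ac)
  have mom: "dot X v (\<lambda>x. (x \<bullet> x) ^ a * mon M x) = moment X a M v" for a M
    by (simp add: moment_def dot_commute)
  have "distance_form X l v = dot X v (\<lambda>x. dot X (\<lambda>y. ((norm (x - y))\<^sup>2) ^ l) v)"
    by (simp add: distance_form_def dot_def)
  then show ?thesis
    unfolding distance_power_row swap scale scale' mom .
qed

text \<open>In each summand one of the two degrees, which add up to \<open>2l\<close>, is at most \<open>l\<close>.\<close>
lemma distance_form_zero:
  assumes "annihilates_below X (Suc l) v"
  shows "distance_form X l v = 0"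
  unfolding distance_form_expand
proof (intro sum.neutral ballI)
  fix k a assume ka: "k \<in> {..l}" "a \<in> {..k}"
  have "moment X a (mset w) v * moment X (k - a) (mset w) v = 0" if "w \<in> words (l - k)" for w
  proof (cases "2 * a + (l - k) < Suc l")
    case True
    then show ?thesis using moment_vanishes[OF assms, of a "mset w"] that by (simp add: words_def)
  next
    case False
    then have "2 * (k - a) + (l - k) < Suc l" using ka by auto
    then show ?thesis using moment_vanishes[OF assms, of "k - a" "mset w"] that by (simp add: words_def)
  qed
  then have "(\<Sum>w\<in>words (l - k). moment X a (mset w) v * moment X (k - a) (mset w) v) = 0"
    by (intro sum.neutral) blast
  then show "real (l choose k) * real (k choose a) * (- 2) ^ (l - k) *
      (\<Sum>w\<in>words (l - k). moment X a (mset w) v * moment X (k - a) (mset w) v) = 0"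
    by simp
qed

text \<open>Only the summands of degree exactly \<open>l\<close> in both points survive, those with \<open>k = 2a\<close>. Such a summand is
\<open>(-2)\<^sup>l\<^sup>-\<^sup>k\<close> times a sum of squares, and its sign is \<open>(-1)\<^sup>l\<close> because \<open>k\<close> is even. So if the form
vanishes, all these squares are zero, and those with \<open>k = 0\<close> are the moments of degree \<open>l\<close>.\<close>
lemma annihilates_below_Suc:
  assumes van: "annihilates_below X l v" and zero: "distance_form X l v = 0"
  shows "annihilates_below X (Suc l) v"
proof -
  define T where "T k a = real (l choose k) * real (k choose a) * (- 2) ^ (l - k) *
      (\<Sum>w\<in>words (l - k). moment X a (mset w) v * moment X (k - a) (mset w) v)" for k a
  have nonneg: "(- 1) ^ l * T k a \<ge> 0" if k: "k \<le> l" and a: "a \<le> k" for k a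
  proof (cases "k = 2 * a")
    case True
    have "(- 1 :: real) ^ l * (- 2) ^ (l - k) = 2 ^ (l - k)"
    proof -
      obtain r where r: "l - k = r" by simp
      then have l: "l = 2 * a + r" using k True by simp
      show ?thesis unfolding r unfolding l by (simp add: power_add power_mult flip: power_mult_distrib)
    qed
    then have "(- 1) ^ l * T k a = real (l choose k) * real (k choose a) * 2 ^ (l - k) *
        (\<Sum>w\<in>words (l - k). (moment X a (mset w) v)\<^sup>2)"
      using True by (simp add: T_def power2_eq_square mult_ac)
    then show ?thesis by (simp add: sum_nonneg)
  next
    case False
    have "moment X a (mset w) v * moment X (k - a) (mset w) v = 0" if "w \<in> words (l - k)" for w
    proof (cases "2 * a + (l - k) < l")
      case True
      then show ?thesis using moment_vanishes[OF van, of a "mset w"] that by (simp add: words_def)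
    next
      case False
      then have "2 * (k - a) + (l - k) < l" using k a \<open>k \<noteq> 2 * a\<close> by auto
      then show ?thesis using moment_vanishes[OF van, of "k - a" "mset w"] that by (simp add: words_def)
    qed
    then have "(\<Sum>w\<in>words (l - k). moment X a (mset w) v * moment X (k - a) (mset w) v) = 0"
      by (intro sum.neutral) blast
    then show ?thesis by (simp add: T_def)
  qed
  have "(\<Sum>k\<le>l. \<Sum>a\<le>k. (- 1) ^ l * T k a) = (- 1) ^ l * distance_form X l v"
    unfolding distance_form_expand T_def by (simp add: sum_distrib_left)
  then have "(\<Sum>k\<le>l. \<Sum>a\<le>k. (- 1) ^ l * T k a) = 0" using zero by simp
  then have "\<forall>k\<in>{..l}. (\<Sum>a\<le>k. (- 1) ^ l * T k a) = 0"
    using nonneg by (subst (asm) sum_nonneg_eq_0_iff) (auto intro!: sum_nonneg)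
  then have "(\<Sum>a\<le>0. (- 1) ^ l * T 0 a) = 0" by (rule bspec) simp
  then have "(\<Sum>w\<in>words l. (dot X (mon (mset w)) v)\<^sup>2) = 0"
    by (simp add: T_def moment_0 power2_eq_square)
  then have "\<And>w. w \<in> words l \<Longrightarrow> dot X (mon (mset w)) v = 0"
    using finite_words by (subst (asm) sum_nonneg_eq_0_iff) auto
  then have "dot X (mon M) v = 0" if "size M = l" for M
    using that ex_mset[of M] by (auto simp: words_def)
  then show ?thesis using van by (auto simp: annihilates_below_def less_Suc_eq)
qed

text \<open>Let \<open>2b + size M \<ge> s\<close> and \<open>e = 2(s - 1) - 2b - size M\<close>. Pulling factors \<open>\<bar>x\<bar>\<^sup>2\<close> out of \<open>\<bar>x\<bar>\<^sup>2\<^sup>b M(x)\<close> leaves a homogeneous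
polynomial of degree \<open>e\<close> multiplied by \<open>\<bar>x\<bar>\<^sup>2\<close> to the power \<open>s - 1 - e\<close>. These products form a small spanning set: it
has one function for each monomial of degree less than \<open>s - 1\<close>, and the constant monomial corresponds
to the excluded function \<open>\<bar>x\<bar>\<^sup>2\<close> to the power \<open>s - 1\<close>.\<close>
lemma high_moments_vanish:
  fixes X :: "(real ^ 'n::finite) set"
  assumes van: "annihilates_below X s v"
    and high: "\<And>M. 1 \<le> size M \<Longrightarrow> size M < s - 1 \<Longrightarrow> moment X (s - 1 - size M) M v = 0"
    and bM: "b + size M < s" "b \<noteq> s - 1"
  shows "moment X b M v = 0"
proof (cases "2 * b + size M < s")
  case True
  then show ?thesis by (rule moment_vanishes[OF van])
next
  case False
  define b' where "b' = s - 1 - b - size M"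
  have "b = (b - b') + b'" using False bM by (simp add: b'_def)
  then have "moment X b M v = (\<Sum>w\<in>words b'. moment X (b - b') (mset w + mset w + M) v)"
    using moment_split[of X "b - b'" b' M v] by simp
  also have "\<dots> = 0"
  proof (intro sum.neutral ballI)
    fix w :: "'n list" assume "w \<in> words b'"
    then have size: "size (mset w + mset w + M) = 2 * b' + size M" by (simp add: words_def)
    then have "b - b' = s - 1 - size (mset w + mset w + M)" using False bM by (simp add: b'_def)
    moreover have "1 \<le> size (mset w + mset w + M)" "size (mset w + mset w + M) < s - 1"
      using False bM unfolding size b'_def by auto
    ultimately show "moment X (b - b') (mset w + mset w + M) v = 0" using high by metis
  qed
  finally show ?thesis .
qed

text \<open>The only moment that remains comes from the term \<open>\<bar>y\<bar>\<^sup>2\<close> to the power \<open>s - 1\<close>, whose coefficient does not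
involve \<open>x\<close>.\<close>
lemma distance_power_row_constant:
  fixes X :: "(real ^ 'n::finite) set"
  assumes van: "\<And>b M. b + size M < s \<Longrightarrow> b \<noteq> s - 1 \<Longrightarrow> moment X b M v = 0" and l: "l < s"
  shows "dot X (\<lambda>y. ((norm (x - y))\<^sup>2) ^ l) v = of_bool (l = s - 1) * moment X (s - 1) {#} v"
proof -
  have "dot X (\<lambda>y. ((norm (x - y))\<^sup>2) ^ l) v =
      (\<Sum>k\<le>l. \<Sum>a\<le>k. if k = l \<and> a = 0 then of_bool (l = s - 1) * moment X (s - 1) {#} v else 0)"
    unfolding distance_power_row
  proof (intro sum.cong refl)
    fix k a assume ka: "k \<in> {..l}" "a \<in> {..k}"
    show "real (l choose k) * real (k choose a) * (- 2) ^ (l - k) *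
        (\<Sum>w\<in>words (l - k). ((x \<bullet> x) ^ a * mon (mset w) x) * moment X (k - a) (mset w) v)
      = (if k = l \<and> a = 0 then of_bool (l = s - 1) * moment X (s - 1) {#} v else 0)"
    proof (cases "k = l \<and> a = 0")
      case True
      then show ?thesis using van[of l "{#}"] l by (auto simp: words_0)
    next
      case False
      then have "moment X (k - a) (mset w) v = 0" if "w \<in> words (l - k)" for w
        using ka l that by (intro van) (auto simp: words_def)
      then have "(\<Sum>w\<in>words (l - k). ((x \<bullet> x) ^ a * mon (mset w) x) * moment X (k - a) (mset w) v) = 0"
        by (intro sum.neutral) simp
      then show ?thesis using False by (simp only: if_False mult_zero_right)
    qed
  qed
  also have "\<dots> = of_bool (l = s - 1) * moment X (s - 1) {#} v"
  proof -
    have "(\<Sum>a\<le>k. if k = l \<and> a = 0 then c else 0) = (if k = l then c else 0)" for k and c :: real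
      by simp
    then show ?thesis by (simp add: sum.delta)
  qed
  finally show ?thesis .
qed

lemma finite_multisets_below: "finite {M :: 'n::finite multiset. size M < s}"
proof -
  have "{M :: 'n multiset. size M < s} = (\<Union>n<s. multisets_of_size UNIV n)"
    by (auto simp: multisets_of_size_def)
  then show ?thesis by (simp add: finite_multisets_of_size)
qed

lemma card_multisets_below:
  assumes "s \<ge> 1"
  shows "card {M :: 'n::finite multiset. size M < s} = (CARD('n) + s - 1) choose (s - 1)"
proof -
  have "{M :: 'n multiset. size M < s} = (\<Union>n\<le>s - 1. multisets_of_size UNIV n)"
    using assms by (auto simp: multisets_of_size_def)
  then have "card {M :: 'n multiset. size M < s} = (\<Sum>n\<le>s - 1. card (multisets_of_size (UNIV :: 'n set) n))"
  proof (simp only:, intro card_UN_disjoint ballI impI)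
    show "finite (multisets_of_size (UNIV :: 'n set) n)" for n by (simp add: finite_multisets_of_size)
  qed (auto simp: multisets_of_size_def)
  also have "\<dots> = (\<Sum>n\<le>s - 1. (CARD('n) - 1 + n) choose n)"
    by (intro sum.cong refl) (simp add: card_multisets_of_size Suc_le_eq)
  also have "\<dots> = (CARD('n) + s - 1) choose (s - 1)"
  proof -
    have "Suc (CARD('n) - 1 + (s - 1)) = CARD('n) + s - 1"
      using assms zero_less_card_finite[where 'a = 'n] by linarith
    then show ?thesis by (simp only: sum_choose_lower)
  qed
  finally show ?thesis .
qed

lemma card_multisets_of_size_mono:
  assumes "l \<le> m"
  shows "card {M :: 'n::finite multiset. size M = l} \<le> card {M :: 'n multiset. size M = m}"
proof (rule card_inj_on_le)
  fix i :: 'n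
  let ?f = "\<lambda>M. M + replicate_mset (m - l) i"
  show "inj_on ?f {M. size M = l}" by (auto simp: inj_on_def)
  show "?f ` {M. size M = l} \<subseteq> {M. size M = m}" using assms by auto
  show "finite {M :: 'n multiset. size M = m}"
    by (rule finite_subset[OF _ finite_multisets_below[of "Suc m"]]) auto
qed

section \<open>Integrality of the ratios\<close>

lemma annihilates_below_mono: "annihilates_below X s v \<Longrightarrow> l \<le> s \<Longrightarrow> annihilates_below X l v"
  by (auto simp: annihilates_below_def)

text \<open>Besides the set of points, the locale names the three numbers in the dimension count: \<open>N\<close> and \<open>N'\<close>
count the monomials of degree less than \<open>s\<close> and less than \<open>s - 1\<close>, and \<open>q\<close> counts those of degree
\<open>s - 1\<close>.\<close>
locale few_distances =
  fixes X :: "(real ^ 'n::finite) set" and \<alpha> :: "nat \<Rightarrow> real" and s N N' q :: nat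
  defines "N \<equiv> card {M :: 'n multiset. size M < s}"
    and "N' \<equiv> card {M :: 'n multiset. size M < s - 1}"
    and "q \<equiv> card {M :: 'n multiset. size M = s - 1}"
  assumes finite_X: "finite X" and s_ge_2: "s \<ge> 2"
    and distances_eq: "distances X = \<alpha> ` {1..s}" and inj_\<alpha>: "inj_on \<alpha> {1..s}"
begin

abbreviation "k \<equiv> distance_ratio s \<alpha>"

definition adj :: "nat \<Rightarrow> real ^ 'n \<Rightarrow> real ^ 'n \<Rightarrow> real" where
  "adj j x y = of_bool (norm (x - y) = \<alpha> j)"

lemma \<alpha>_pos: "j \<in> {1..s} \<Longrightarrow> \<alpha> j > 0"
proof -
  assume "j \<in> {1..s}"
  then have "\<alpha> j \<in> distances X" using distances_eq by blast
  then show ?thesis by (auto simp: distances_def)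
qed

lemma \<alpha>_square_inj:
  assumes "i \<in> {1..s}" "j \<in> {1..s}" "i \<noteq> j"
  shows "(\<alpha> i)\<^sup>2 \<noteq> (\<alpha> j)\<^sup>2"
  using \<alpha>_pos assms inj_onD[OF inj_\<alpha>] by (smt (verit) power2_eq_imp_eq)

lemma symmetric_adj: "symmetric_kernel (adj j)"
  by (simp add: symmetric_kernel_def adj_def norm_minus_commute)

lemma distance_cases:
  assumes "x \<in> X" "y \<in> X" "x \<noteq> y"
  obtains j where "j \<in> {1..s}" "norm (x - y) = \<alpha> j" "\<And>i. i \<in> {1..s} \<Longrightarrow> adj i x y = of_bool (i = j)"
proof -
  have "norm (x - y) \<in> distances X" using assms unfolding distances_def by blast
  then obtain j where j: "j \<in> {1..s}" "norm (x - y) = \<alpha> j" using distances_eq by auto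
  then have "adj i x y = of_bool (i = j)" if "i \<in> {1..s}" for i
    using that inj_onD[OF inj_\<alpha>] by (auto simp: adj_def)
  then show ?thesis using that j by blast
qed

lemma adj_diagonal: "j \<in> {1..s} \<Longrightarrow> adj j x x = 0"
  using \<alpha>_pos[of j] by (simp add: adj_def)

text \<open>The Lagrange polynomial with value 1 at \<open>(\<alpha> i)\<^sup>2\<close> and value 0 at the other squared distances. Its value at 0
is the ratio \<open>k i\<close>, the diagonal entry of the matrix it produces from the squared distances.\<close>
definition selector :: "nat \<Rightarrow> real poly" where
  "selector i = (\<Prod>j\<in>{1..s} - {i}. smult (1 / ((\<alpha> j)\<^sup>2 - (\<alpha> i)\<^sup>2)) [:(\<alpha> j)\<^sup>2, - 1:])"

lemma poly_selector_0: "poly (selector i) 0 = k i"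
  by (simp add: selector_def poly_prod distance_ratio_def)

lemma poly_selector:
  assumes "i \<in> {1..s}" "j \<in> {1..s}"
  shows "poly (selector i) ((\<alpha> j)\<^sup>2) = of_bool (i = j)"
proof (cases "i = j")
  case True
  then show ?thesis using \<alpha>_square_inj assms
    by (auto simp: selector_def poly_prod divide_simps intro!: prod.neutral)
next
  case False
  then show ?thesis using assms by (auto simp: selector_def poly_prod intro!: prod_zero bexI[of _ j])
qed

lemma poly_selector_sum:
  assumes "i \<in> {1..s}"
  shows "poly (selector i) z = (\<Sum>l<s. coeff (selector i) l * z ^ l)"
proof -
  have "degree (selector i) \<le> (\<Sum>j\<in>{1..s} - {i}. degree (smult (1 / ((\<alpha> j)\<^sup>2 - (\<alpha> i)\<^sup>2)) [:(\<alpha> j)\<^sup>2, - 1:]))"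
    unfolding selector_def by (rule order_trans[OF degree_prod_sum_le]) (auto simp: o_def)
  also have "\<dots> \<le> (\<Sum>j\<in>{1..s} - {i}. 1)"
    by (intro sum_mono) (simp add: degree_smult_eq)
  also have "\<dots> < s" using assms s_ge_2 by (simp add: card_Diff_singleton)
  finally show ?thesis unfolding poly_altdef
    by (intro sum.mono_neutral_left) (auto simp: coeff_eq_0)
qed

lemma selector_distance:
  assumes "i \<in> {1..s}" "x \<in> X" "y \<in> X"
  shows "(\<Sum>l<s. coeff (selector i) l * ((norm (x - y))\<^sup>2) ^ l) = adj i x y + k i * of_bool (x = y)"
proof (cases "x = y")
  case True
  then show ?thesis using assms poly_selector_0[of i]
    unfolding poly_selector_sum[OF assms(1), symmetric] by (simp add: adj_diagonal)
next
  case False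
  then obtain j where "j \<in> {1..s}" "norm (x - y) = \<alpha> j" "adj i x y = of_bool (i = j)"
    using distance_cases assms by metis
  then show ?thesis using False assms(1)
    by (simp add: poly_selector_sum[OF assms(1), symmetric] poly_selector)
qed

lemma adj_row:
  assumes "i \<in> {1..s}" "x \<in> X"
  shows "dot X (adj i x) v + k i * v x = (\<Sum>l<s. coeff (selector i) l * dot X (\<lambda>y. ((norm (x - y))\<^sup>2) ^ l) v)"
proof -
  have "dot X (adj i x) v + k i * v x = (\<Sum>y\<in>X. (adj i x y + k i * of_bool (x = y)) * v y)"
  proof -
    have "(\<Sum>y\<in>X. k i * of_bool (x = y) * v y) = k i * v x"
      using finite_X assms(2) by (subst sum.mono_neutral_right[of X "{x}"]) auto
    then show ?thesis by (simp add: dot_def distrib_right sum.distrib)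
  qed
  also have "\<dots> = (\<Sum>y\<in>X. \<Sum>l<s. coeff (selector i) l * (((norm (x - y))\<^sup>2) ^ l * v y))"
    by (intro sum.cong refl) (simp only: selector_distance[OF assms, symmetric] sum_distrib_right mult.assoc)
  also have "\<dots> = (\<Sum>l<s. coeff (selector i) l * dot X (\<lambda>y. ((norm (x - y))\<^sup>2) ^ l) v)"
    by (subst sum.swap) (simp add: dot_def sum_distrib_left)
  finally show ?thesis .
qed

lemma dot_app: "dot X v (app X b v) = (\<Sum>x\<in>X. v x * dot X (b x) v)"
  by (simp add: dot_def app_def)

text \<open>The matrix \<open>A\<^sub>i + k\<^sub>i I\<close> is a combination of the forms \<open>distance_form X l\<close> with \<open>l < s\<close>, all of which
vanish at \<open>v\<close>.\<close>
lemma adj_form: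
  assumes "i \<in> {1..s}" "annihilates_below X s v"
  shows "dot X v (app X (adj i) v) = - k i * dot X v v"
proof -
  have "dot X v (app X (adj i) v) + k i * dot X v v = (\<Sum>x\<in>X. v x * (dot X (adj i x) v + k i * v x))"
    unfolding dot_app by (simp add: dot_def[of X v v] algebra_simps sum.distrib sum_distrib_left)
  also have "\<dots> = (\<Sum>x\<in>X. \<Sum>l<s. coeff (selector i) l * (v x * dot X (\<lambda>y. ((norm (x - y))\<^sup>2) ^ l) v))"
    using adj_row[OF assms(1)] by (intro sum.cong refl) (simp add: sum_distrib_left mult_ac)
  also have "\<dots> = (\<Sum>l<s. coeff (selector i) l * distance_form X l v)"
    by (subst sum.swap) (simp add: distance_form_def sum_distrib_left)
  also have "\<dots> = 0"
    using distance_form_zero[OF annihilates_below_mono[OF assms(2)]] by (intro sum.neutral) auto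
  finally show ?thesis by simp
qed

lemma distance_form_adj:
  assumes "l \<ge> 1"
  shows "distance_form X l v = (\<Sum>j\<in>{1..s}. ((\<alpha> j)\<^sup>2) ^ l * dot X v (app X (adj j) v))"
proof -
  have power: "((norm (x - y))\<^sup>2) ^ l = (\<Sum>j\<in>{1..s}. ((\<alpha> j)\<^sup>2) ^ l * adj j x y)" if xy: "x \<in> X" "y \<in> X" for x y
  proof (cases "x = y")
    case True
    then show ?thesis using assms by (simp add: adj_diagonal)
  next
    case False
    then obtain j where "j \<in> {1..s}" "norm (x - y) = \<alpha> j" "\<And>i. i \<in> {1..s} \<Longrightarrow> adj i x y = of_bool (i = j)"
      using distance_cases[OF xy] by metis
    then have "(\<Sum>i\<in>{1..s}. ((\<alpha> i)\<^sup>2) ^ l * adj i x y) = (\<Sum>i\<in>{1..s}. if i = j then ((\<alpha> j)\<^sup>2) ^ l else 0)"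
      by (intro sum.cong) auto
    then show ?thesis using \<open>j \<in> _\<close> \<open>norm _ = _\<close> by simp
  qed
  have "dot X (\<lambda>y. ((norm (x - y))\<^sup>2) ^ l) v = (\<Sum>j\<in>{1..s}. ((\<alpha> j)\<^sup>2) ^ l * dot X (adj j x) v)" if "x \<in> X" for x
  proof -
    have "dot X (\<lambda>y. ((norm (x - y))\<^sup>2) ^ l) v = (\<Sum>y\<in>X. \<Sum>j\<in>{1..s}. ((\<alpha> j)\<^sup>2) ^ l * (adj j x y * v y))"
      unfolding dot_def
      by (intro sum.cong refl) (simp only: power[OF that] sum_distrib_right mult.assoc)
    then show ?thesis by (subst (asm) sum.swap) (simp add: dot_def sum_distrib_left)
  qed
  then have "distance_form X l v = (\<Sum>x\<in>X. \<Sum>j\<in>{1..s}. ((\<alpha> j)\<^sup>2) ^ l * (v x * dot X (adj j x) v))"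
    unfolding distance_form_def by (intro sum.cong refl) (simp add: sum_distrib_left mult_ac)
  then show ?thesis unfolding dot_app by (subst (asm) sum.swap) (simp add: sum_distrib_left)
qed

definition row_mean :: "nat \<Rightarrow> real ^ 'n \<Rightarrow> real" where
  "row_mean j x = dot X (\<lambda>_. 1) (adj j x) / card X"

text \<open>The matrix \<open>P A\<^sub>j P\<close>, where \<open>P\<close> is the orthogonal projection onto the vectors of sum zero. Compressing to
these vectors turns the relation \<open>A\<^sub>j v + k\<^sub>j v = const\<close> into an eigenvalue equation. Vectors with a
nonzero constant are thereby admitted, and they supply the one extra dimension that decides the count
when \<open>card X = 2 * N\<close>.\<close>
definition centred :: "nat \<Rightarrow> real ^ 'n \<Rightarrow> real ^ 'n \<Rightarrow> real" where
  "centred j x y = adj j x y - row_mean j x - row_mean j y + dot X (\<lambda>_. 1) (row_mean j) / card X"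

lemma symmetric_centred: "symmetric_kernel (centred j)"
  using symmetric_adj by (simp add: symmetric_kernel_def centred_def)

lemma centred_rational: "centred j x y \<in> \<rat>"
proof -
  have adj: "adj j x y \<in> \<rat>" for x y by (simp add: adj_def)
  then have "row_mean j x \<in> \<rat>" for x
    unfolding row_mean_def by (intro Rats_divide dot_rational) auto
  then show ?thesis unfolding centred_def
    using adj by (intro Rats_add Rats_diff Rats_divide dot_rational) auto
qed

lemma centred_row:
  assumes "dot X (\<lambda>_. 1) v = 0"
  shows "dot X (centred j x) v = dot X (adj j x) v - dot X (row_mean j) v"
proof -
  have "dot X (centred j x) v = dot X (adj j x) v - dot X (row_mean j) v
      + (dot X (\<lambda>_. 1) (row_mean j) / card X - row_mean j x) * dot X (\<lambda>_. 1) v"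
  proof -
    have "(\<Sum>y\<in>X. (f y - a - g y + c) * v y) = (\<Sum>y\<in>X. f y * v y) - (\<Sum>y\<in>X. g y * v y) + (c - a) * (\<Sum>y\<in>X. 1 * v y)"
      for f g a c
      by (simp add: algebra_simps sum.distrib sum_subtractf sum_distrib_left)
    then show ?thesis by (simp only: dot_def centred_def)
  qed
  then show ?thesis using assms by simp
qed

abbreviation "E \<equiv> eigenspace X {1..s} centred (\<lambda>_. 1)"

lemma E_form:
  assumes "v \<in> E \<theta>" "j \<in> {1..s}"
  shows "dot X v (app X (adj j) v) = \<theta> j * dot X v v"
proof -
  have v: "dot X (\<lambda>_. 1) v = 0" "app X (centred j) v = (\<lambda>x. \<theta> j * v x)"
    using assms by (auto simp: eigenspace_def)
  have "\<theta> j * dot X v v = dot X v (app X (centred j) v)"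
    unfolding v(2) by (simp add: dot_def sum_distrib_left mult_ac)
  also have "\<dots> = (\<Sum>x\<in>X. v x * dot X (adj j x) v - dot X (row_mean j) v * (1 * v x))"
    unfolding dot_app centred_row[OF v(1)] by (simp add: algebra_simps)
  also have "\<dots> = dot X v (app X (adj j) v) - dot X (row_mean j) v * dot X (\<lambda>_. 1) v"
    unfolding dot_app dot_def[of X "\<lambda>_. 1"] by (simp only: sum_subtractf sum_distrib_left)
  finally show ?thesis using v(1) by simp
qed

text \<open>On \<open>E \<theta>\<close> the form of \<open>\<bar>x - y\<bar>\<^sup>2\<^sup>l\<close> is the scalar \<open>\<mu> l\<close>. As long as these scalars are zero, the vectors of
\<open>E \<theta>\<close> annihilate polynomials of higher and higher degree. At the first nonzero scalar \<open>\<mu> l\<close> a vector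
whose moments of degree \<open>l\<close> vanish too must be zero, and there are at most \<open>q\<close> such moments. If there
is no nonzero scalar, \<open>adj_form\<close> shows that \<open>E \<theta>\<close> is trivial.\<close>
lemma other_eigenspaces_separated:
  assumes other: "\<exists>j\<in>{1..s}. \<theta> j \<noteq> - k j"
  shows "separated X q (E \<theta>)"
proof -
  define \<mu> where "\<mu> l = (\<Sum>j\<in>{1..s}. ((\<alpha> j)\<^sup>2) ^ l * \<theta> j)" for l
  note sub = subspace_on_eigenspace[of X "{1..s}" centred "\<lambda>_. 1" \<theta>]
  have form: "distance_form X l v = \<mu> l * dot X v v" if "l \<ge> 1" "v \<in> E \<theta>" for l v
    unfolding distance_form_adj[OF that(1)] \<mu>_def using E_form[OF that(2)]
    by (simp add: sum_distrib_right sum_distrib_left mult_ac)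
  have kills: "annihilates_below X m v" if "\<And>l. 1 \<le> l \<Longrightarrow> l < m \<Longrightarrow> \<mu> l = 0" "m \<ge> 1" "v \<in> E \<theta>" for m v
    using that
  proof (induction m)
    case (Suc m)
    show ?case
    proof (cases "m = 0")
      case True
      have "mon {#} = (\<lambda>_ :: real ^ 'n. 1)" by auto
      then show ?thesis using True Suc.prems(3) by (simp add: annihilates_below_def eigenspace_def)
    next
      case False
      then have "annihilates_below X m v" using Suc by simp
      moreover have "distance_form X m v = 0" using form[of m v] Suc.prems False by simp
      ultimately show ?thesis by (rule annihilates_below_Suc)
    qed
  qed simp
  show ?thesis
  proof (cases "\<exists>l. 1 \<le> l \<and> l < s \<and> \<mu> l \<noteq> 0")
    case True
    define l where "l = (LEAST l. 1 \<le> l \<and> l < s \<and> \<mu> l \<noteq> 0)"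
    have l: "1 \<le> l" "l < s" "\<mu> l \<noteq> 0" using LeastI_ex[OF True] by (auto simp: l_def)
    have least: "\<mu> m = 0" if "1 \<le> m" "m < l" for m
      using not_less_Least[of m "\<lambda>l. 1 \<le> l \<and> l < s \<and> \<mu> l \<noteq> 0"] that l(2) by (simp add: l_def)
    let ?G = "mon ` {M :: 'n multiset. size M = l}"
    have fin: "finite {M :: 'n multiset. size M = l}"
      by (rule finite_subset[OF _ finite_multisets_below[of "Suc l"]]) auto
    have "v = (\<lambda>_. 0)" if v: "v \<in> E \<theta>" "\<forall>g\<in>?G. dot X g v = 0" for v
    proof -
      have "annihilates_below X l v" using least l(1) v(1) by (intro kills) auto
      then have "annihilates_below X (Suc l) v" using v(2) by (auto simp: annihilates_below_def less_Suc_eq)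
      then have "distance_form X l v = 0" by (rule distance_form_zero)
      then have "dot X v v = 0" using form[OF l(1) v(1)] l(3) by simp
      then show ?thesis by (rule subspace_on_dot_self[OF sub finite_X v(1)])
    qed
    moreover have "l \<le> s - 1" using l(2) by simp
    then have "card ?G \<le> q"
      using card_image_le[OF fin, of mon] card_multisets_of_size_mono[of l "s - 1", where 'n = 'n] l by (simp add: q_def)
    ultimately show ?thesis using fin unfolding separated_def by (intro exI[of _ ?G]) auto
  next
    case False
    obtain j where j: "j \<in> {1..s}" "\<theta> j \<noteq> - k j" using other by blast
    have "v = (\<lambda>_. 0)" if v: "v \<in> E \<theta>" for v
    proof -
      have "annihilates_below X s v" using False s_ge_2 v by (intro kills) auto
      then have "\<theta> j * dot X v v = - k j * dot X v v" using adj_form[OF j(1)] E_form[OF v j(1)] by simp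
      then have "(\<theta> j - - k j) * dot X v v = 0" by (simp add: algebra_simps)
      then have "dot X v v = 0" using j(2) by (metis mult_eq_0_iff right_minus_eq)
      then show ?thesis by (rule subspace_on_dot_self[OF sub finite_X v])
    qed
    then show ?thesis unfolding separated_def by (intro exI[of _ "{}"]) auto
  qed
qed

lemma N_split: "N = N' + q"
proof -
  have "{M :: 'n multiset. size M < s} = {M. size M < s - 1} \<union> {M. size M = s - 1}"
    using s_ge_2 by auto
  moreover have "finite {M :: 'n multiset. size M = s - 1}"
    by (rule finite_subset[OF _ finite_multisets_below[of "Suc (s - 1)"]]) auto
  ultimately show ?thesis unfolding N_def N'_def q_def
    using finite_multisets_below[of "s - 1", where 'n = 'n] by (simp only:) (rule card_Un_disjoint, auto)
qed

lemma q_pos: "q \<ge> 1"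
  unfolding q_def using card_multisets_of_size_mono[of 0 "s - 1", where 'n = 'n] by simp

text \<open>It suffices to kill the \<open>N\<close> monomials of degree less than \<open>s\<close> and one further function for each
nonconstant monomial of degree less than \<open>s - 1\<close>.\<close>
lemma moment_kernel:
  assumes "finite G" "card G + N + N' \<le> card X"
  shows "\<exists>v. v \<noteq> (\<lambda>_. 0) \<and> (\<forall>x. x \<notin> X \<longrightarrow> v x = 0) \<and> annihilates_below X s v \<and>
    (\<forall>b M. b + size M < s \<longrightarrow> b \<noteq> s - 1 \<longrightarrow> moment X b M v = 0) \<and> (\<forall>g\<in>G. dot X g v = 0)"
proof -
  let ?A = "mon ` {M :: 'n multiset. size M < s}"
  let ?f = "\<lambda>M x. (x \<bullet> x) ^ (s - 1 - size M) * mon M x"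
  let ?I = "{M :: 'n multiset. size M < s - 1} - {{#}}"
  have fin: "finite {M :: 'n multiset. size M < s}" "finite ?I"
    using finite_multisets_below[of _, where 'n = 'n] by auto
  have "card ?I < N'"
    unfolding N'_def by (rule card_Diff1_less[OF finite_multisets_below]) (use s_ge_2 in simp)
  then have "card (?f ` ?I) < N'" using card_image_le[OF fin(2), of ?f] by linarith
  moreover have "card ?A \<le> N" unfolding N_def using fin(1) by (rule card_image_le)
  moreover have "card (G \<union> ?A \<union> ?f ` ?I) \<le> card G + card ?A + card (?f ` ?I)"
    using card_Un_le[of "G \<union> ?A" "?f ` ?I"] card_Un_le[of G ?A] by linarith
  ultimately have "card (G \<union> ?A \<union> ?f ` ?I) < card X" using assms(2) by linarith
  then obtain w where w: "\<exists>x\<in>X. w x \<noteq> 0" "\<forall>g\<in>G \<union> ?A \<union> ?f ` ?I. dot X g w = 0"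
    using underdetermined_system[OF finite_X, of "G \<union> ?A \<union> ?f ` ?I" "\<lambda>g. g"] assms(1) fin by auto
  define v where "v x = (if x \<in> X then w x else 0)" for x
  have v: "dot X g v = dot X g w" for g by (simp add: dot_def v_def)
  have kills: "annihilates_below X s v" using w(2) by (auto simp: annihilates_below_def v)
  have "moment X (s - 1 - size M) M v = 0" if "1 \<le> size M" "size M < s - 1" for M
  proof -
    have "M \<in> ?I" using that by auto
    then show ?thesis using w(2) unfolding moment_def v by blast
  qed
  then have "\<forall>b M. b + size M < s \<longrightarrow> b \<noteq> s - 1 \<longrightarrow> moment X b M v = 0"
    using high_moments_vanish[OF kills] by blast
  moreover have "v \<noteq> (\<lambda>_. 0)" using w(1) by (auto simp: v_def fun_eq_iff)
  ultimately show ?thesis using kills w(2) by (intro exI[of _ v]) (auto simp: v v_def)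
qed

lemma adj_row_constant:
  assumes "\<And>b M. b + size M < s \<Longrightarrow> b \<noteq> s - 1 \<Longrightarrow> moment X b M v = 0" "i \<in> {1..s}" "x \<in> X"
  shows "dot X (adj i x) v = coeff (selector i) (s - 1) * moment X (s - 1) {#} v - k i * v x"
proof -
  have "dot X (adj i x) v + k i * v x
      = (\<Sum>l<s. if l = s - 1 then coeff (selector i) (s - 1) * moment X (s - 1) {#} v else 0)"
    unfolding adj_row[OF assms(2,3)] using distance_power_row_constant[OF assms(1)]
    by (intro sum.cong refl) auto
  also have "\<dots> = coeff (selector i) (s - 1) * moment X (s - 1) {#} v" using s_ge_2 by simp
  finally show ?thesis by simp
qed

text \<open>Given \<open>q\<close> further functionals, \<open>q + N + N' = 2 * N\<close> is small enough for \<open>moment_kernel\<close>. A vector found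
there satisfies \<open>A\<^sub>j v + k\<^sub>j v = const\<close> and has sum zero, so it is an eigenvector of the centred matrix.\<close>
lemma eigenspace_not_separated:
  assumes "2 * N \<le> card X"
  shows "\<not> separated X q (E (\<lambda>j. - k j))"
proof
  assume "separated X q (E (\<lambda>j. - k j))"
  then obtain G where G: "finite G" "card G \<le> q"
    "\<And>v. v \<in> E (\<lambda>j. - k j) \<Longrightarrow> \<forall>g\<in>G. dot X g v = 0 \<Longrightarrow> v = (\<lambda>_. 0)"
    unfolding separated_def by blast
  have "card G + N + N' \<le> card X" using assms G(2) N_split by linarith
  from moment_kernel[OF G(1) this] obtain v where v: "v \<noteq> (\<lambda>_. 0)" "\<forall>x. x \<notin> X \<longrightarrow> v x = 0"
    "annihilates_below X s v" "\<And>b M. b + size M < s \<Longrightarrow> b \<noteq> s - 1 \<Longrightarrow> moment X b M v = 0" "\<forall>g\<in>G. dot X g v = 0"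
    by blast
  have "mon {#} = (\<lambda>_ :: real ^ 'n. 1)" by auto
  moreover have "dot X (mon {#}) v = 0" using v(3) s_ge_2 unfolding annihilates_below_def by force
  ultimately have mean: "dot X (\<lambda>_. 1) v = 0" by metis
  have "app X (centred j) v = (\<lambda>x. - k j * v x)" if j: "j \<in> {1..s}" for j
  proof (rule ext)
    fix x
    define c where "c = coeff (selector j) (s - 1) * moment X (s - 1) {#} v"
    have row: "dot X (adj j x) v = c - k j * v x" if "x \<in> X" for x
      using adj_row_constant[OF v(4) j that] by (simp add: c_def)
    have "card X > 0" using v(1,2) finite_X by (auto simp: card_gt_0_iff fun_eq_iff)
    have "dot X (row_mean j) v = (\<Sum>y\<in>X. \<Sum>z\<in>X. adj j z y * v y) / card X"
      using symmetric_adj[of j] unfolding symmetric_kernel_def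
      by (simp add: dot_def row_mean_def sum_distrib_right sum_divide_distrib)
    also have "\<dots> = (\<Sum>z\<in>X. dot X (adj j z) v) / card X"
      by (subst sum.swap) (simp add: dot_def)
    also have "\<dots> = (\<Sum>z\<in>X. c - k j * (1 * v z)) / card X"
      using row by simp
    also have "\<dots> = (card X * c - k j * dot X (\<lambda>_. 1) v) / card X"
      by (simp only: sum_subtractf sum_distrib_left dot_def sum_constant)
    also have "\<dots> = c" using mean \<open>card X > 0\<close> by simp
    finally have "dot X (row_mean j) v = c" .
    then show "app X (centred j) v x = - k j * v x"
      using centred_row[OF mean] row v(2) by (simp add: app_def)
  qed
  then have "v \<in> E (\<lambda>j. - k j)" using v(2) mean by (simp add: eigenspace_def)
  then show False using G(3) v(1,5) by blast
qed

text \<open>Killing in addition the function \<open>\<bar>x\<bar>\<^sup>2\<close> to the power \<open>s - 1\<close> makes the constant in \<open>adj_row_constant\<close> zero,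
so \<open>- k i\<close> is an eigenvalue of the integer matrix \<open>A\<^sub>i\<close>.\<close>
lemma ratio_integer:
  assumes "2 * N \<le> card X" "i \<in> {1..s}"
  shows "k i \<in> \<int>"
proof -
  have "- k i \<in> \<rat>"
    by (rule exceptional_eigenvalue_rational[where \<kappa> = "\<lambda>j. - k j", OF finite_X finite_atLeastAtMost
      symmetric_centred centred_rational _ eigenspace_not_separated[OF assms(1)] other_eigenspaces_separated assms(2)]) auto
  have "card {\<lambda>x :: real ^ 'n. (x \<bullet> x) ^ (s - 1)} + N + N' \<le> card X"
    using assms(1) N_split q_pos by simp
  from moment_kernel[OF _ this] obtain v where v: "v \<noteq> (\<lambda>_. 0)" "\<forall>x. x \<notin> X \<longrightarrow> v x = 0"
    "\<And>b M. b + size M < s \<Longrightarrow> b \<noteq> s - 1 \<Longrightarrow> moment X b M v = 0" "dot X (\<lambda>x. (x \<bullet> x) ^ (s - 1)) v = 0"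
    by auto
  have "moment X (s - 1) {#} v = 0" using v(4) by (simp add: moment_def)
  then have row: "dot X (adj i x) v = - k i * v x" if "x \<in> X" for x
    using adj_row_constant[OF v(3) assms(2) that] by simp
  obtain x0 where "x0 \<in> X" "v x0 \<noteq> 0" using v(1,2) by (metis ext)
  then have "- k i \<in> \<int>"
    using integer_eigenvalue[OF finite_X _ \<open>- k i \<in> \<rat>\<close>, of "adj i" x0 v] row by (simp add: adj_def)
  then show ?thesis by simp
qed

end

section \<open>The bound on the ratios\<close>

text \<open>The Gram-Schmidt process, with \<open>underdetermined_system\<close> providing the next vector.\<close>
lemma orthonormal_system:
  assumes fin: "finite X" "finite G" and p: "card G + p \<le> card X"
  shows "\<exists>e :: nat \<Rightarrow> 'a \<Rightarrow> real. (\<forall>a<p. \<forall>g\<in>G. dot X g (e a) = 0) \<and>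
    (\<forall>a<p. \<forall>b<p. dot X (e a) (e b) = of_bool (a = b))"
  using p
proof (induction p)
  case (Suc p)
  then obtain e :: "nat \<Rightarrow> 'a \<Rightarrow> real" where e: "\<forall>a<p. \<forall>g\<in>G. dot X g (e a) = 0"
    "\<forall>a<p. \<forall>b<p. dot X (e a) (e b) = of_bool (a = b)" by auto
  have "card (G \<union> e ` {..<p}) < card X"
    using card_Un_le[of G "e ` {..<p}"] card_image_le[of "{..<p}" e] Suc.prems by simp
  then obtain v where v: "\<exists>x\<in>X. v x \<noteq> 0" "\<forall>g\<in>G \<union> e ` {..<p}. dot X g v = 0"
    using underdetermined_system[OF fin(1), of "G \<union> e ` {..<p}" "\<lambda>g. g"] fin(2) by auto
  have "dot X v v \<noteq> 0" using v(1) dot_self_eq_0[OF fin(1)] by blast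
  then have pos: "dot X v v > 0" using dot_self_nonneg[of X v] by simp
  define c where "c = 1 / sqrt (dot X v v)"
  define w where "w = (\<lambda>x. c * v x)"
  have w: "dot X u w = c * dot X u v" for u by (simp add: w_def dot_def sum_distrib_left mult_ac)
  have ww: "dot X w w = 1"
  proof -
    have "dot X w w = c * c * dot X v v" using w[of w] w[of v] by (simp add: dot_commute[of X w v])
    then show ?thesis using pos by (simp add: c_def)
  qed
  have new: "dot X (e a) w = 0" "dot X w (e a) = 0" if "a < p" for a
    using v(2) that by (auto simp: w dot_commute[of X w])
  show ?case
  proof (intro exI[of _ "e(p := w)"] conjI allI impI ballI)
    show "dot X g ((e(p := w)) a) = 0" if "a < Suc p" "g \<in> G" for a g
      using that e(1) v(2) w by (auto simp: less_Suc_eq)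
    show "dot X ((e(p := w)) a) ((e(p := w)) b) = of_bool (a = b)" if "a < Suc p" "b < Suc p" for a b
      using that e(2) new ww by (auto simp: less_Suc_eq)
  qed
qed auto

text \<open>Let \<open>P\<close> be the projection onto the span of the \<open>e i\<close>. Both \<open>tr (b P) = p c\<close> and \<open>tr b = 0\<close> are known, so
compare \<open>b\<close> with the traceless combination \<open>Z = n P - p I\<close>: then \<open>tr (b Z) = n p c\<close>, the squared
norm of \<open>Z\<close> is \<open>n p (n - p)\<close>, that of \<open>b\<close> is at most \<open>n (n - 1)\<close>, and the Cauchy-Schwarz inequality
gives the claim.\<close>
lemma sign_matrix_compression_bound:
  fixes b :: "'a \<Rightarrow> 'a \<Rightarrow> real"
  assumes fin: "finite X" and diag: "\<And>x. x \<in> X \<Longrightarrow> b x x = 0"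
    and sgn: "\<And>x y. x \<in> X \<Longrightarrow> y \<in> X \<Longrightarrow> \<bar>b x y\<bar> \<le> 1"
    and e: "\<And>i j. i < p \<Longrightarrow> j < p \<Longrightarrow> dot X (e i) (e j) = of_bool (i = j)"
    and form: "\<And>i. i < p \<Longrightarrow> dot X (e i) (app X b (e i)) = c"
    and p: "0 < p" "p < card X"
  shows "c\<^sup>2 * real p \<le> (real (card X) - 1) * (real (card X) - real p)"
proof -
  define n where "n = real (card X)"
  define P where "P x y = (\<Sum>i<p. e i x * e i y)" for x y
  define Z where "Z x y = n * P x y - p * of_bool (x = y)" for x y
  have n: "n > 0" "n > p" "card X > 0" using p by (auto simp: n_def)
  have delta: "(\<Sum>y\<in>X. of_bool (x = y) * f y) = f x" if "x \<in> X" for x and f :: "'a \<Rightarrow> real"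
    using fin that by (subst sum.mono_neutral_right[of X "{x}"]) auto
  have tr: "(\<Sum>x\<in>X. P x x) = p"
  proof -
    have "(\<Sum>x\<in>X. P x x) = (\<Sum>i<p. dot X (e i) (e i))"
      unfolding P_def dot_def by (rule sum.swap)
    then show ?thesis using e by simp
  qed
  have PP: "(\<Sum>x\<in>X. \<Sum>y\<in>X. (P x y)\<^sup>2) = p"
  proof -
    have "(\<Sum>x\<in>X. \<Sum>y\<in>X. (P x y)\<^sup>2)
        = (\<Sum>x\<in>X. \<Sum>y\<in>X. \<Sum>i<p. \<Sum>j<p. (e i x * e j x) * (e i y * e j y))"
      by (simp add: P_def power2_eq_square sum_product mult_ac)
    also have "\<dots> = (\<Sum>x\<in>X. \<Sum>i<p. \<Sum>j<p. \<Sum>y\<in>X. (e i x * e j x) * (e i y * e j y))"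
      by (subst sum.swap, subst (2) sum.swap) (rule refl)
    also have "\<dots> = (\<Sum>i<p. \<Sum>j<p. \<Sum>x\<in>X. \<Sum>y\<in>X. (e i x * e j x) * (e i y * e j y))"
      by (subst sum.swap, subst (2) sum.swap) (rule refl)
    also have "\<dots> = (\<Sum>i<p. \<Sum>j<p. (dot X (e i) (e j))\<^sup>2)"
      by (simp add: dot_def power2_eq_square sum_product)
    also have "\<dots> = (\<Sum>i<p. \<Sum>j<p. if j = i then 1 else 0)"
      using e by (intro sum.cong refl) auto
    also have "\<dots> = p" by simp
    finally show ?thesis .
  qed
  have ZZ: "(\<Sum>x\<in>X. \<Sum>y\<in>X. (Z x y)\<^sup>2) = n * p * (n - p)"
  proof -
    have "(\<Sum>y\<in>X. (Z x y)\<^sup>2) = n\<^sup>2 * (\<Sum>y\<in>X. (P x y)\<^sup>2) - 2 * n * p * P x x + p\<^sup>2" if "x \<in> X" for x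
    proof -
      have "(Z x y)\<^sup>2 = n\<^sup>2 * (P x y)\<^sup>2 - of_bool (x = y) * (2 * n * p * P x y - p\<^sup>2)" for y
        by (simp add: Z_def power2_eq_square algebra_simps)
      then show ?thesis using delta[OF that, of "\<lambda>y. 2 * n * p * P x y - p\<^sup>2"]
        by (simp add: sum_subtractf sum_distrib_left)
    qed
    then have "(\<Sum>x\<in>X. \<Sum>y\<in>X. (Z x y)\<^sup>2)
        = n\<^sup>2 * (\<Sum>x\<in>X. \<Sum>y\<in>X. (P x y)\<^sup>2) - 2 * n * p * (\<Sum>x\<in>X. P x x) + n * p\<^sup>2"
      by (simp add: sum.distrib sum_subtractf sum_distrib_left n_def)
    then show ?thesis unfolding PP tr by (simp add: power2_eq_square algebra_simps)
  qed
  have bZ: "(\<Sum>x\<in>X. \<Sum>y\<in>X. b x y * Z x y) = n * p * c"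
  proof -
    have "(\<Sum>y\<in>X. b x y * Z x y) = n * (\<Sum>y\<in>X. b x y * P x y)" if "x \<in> X" for x
    proof -
      have "b x y * Z x y = n * (b x y * P x y) - of_bool (x = y) * (p * b x y)" for y
        by (simp add: Z_def algebra_simps)
      then show ?thesis using delta[OF that, of "\<lambda>y. p * b x y"] diag[OF that]
        by (simp add: sum_subtractf sum_distrib_left)
    qed
    then have "(\<Sum>x\<in>X. \<Sum>y\<in>X. b x y * Z x y) = n * (\<Sum>x\<in>X. \<Sum>y\<in>X. \<Sum>i<p. e i x * (b x y * e i y))"
      by (simp add: P_def sum_distrib_left mult_ac)
    also have "(\<Sum>x\<in>X. \<Sum>y\<in>X. \<Sum>i<p. e i x * (b x y * e i y)) = (\<Sum>x\<in>X. \<Sum>i<p. \<Sum>y\<in>X. e i x * (b x y * e i y))"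
      by (intro sum.cong refl sum.swap)
    also have "\<dots> = (\<Sum>i<p. \<Sum>x\<in>X. \<Sum>y\<in>X. e i x * (b x y * e i y))" by (rule sum.swap)
    also have "\<dots> = (\<Sum>i<p. dot X (e i) (app X b (e i)))"
      by (simp add: dot_def app_def sum_distrib_left)
    finally show ?thesis using form by simp
  qed
  have bb: "(\<Sum>x\<in>X. \<Sum>y\<in>X. (b x y)\<^sup>2) \<le> n * (n - 1)"
  proof -
    have "(\<Sum>y\<in>X. (b x y)\<^sup>2) \<le> n - 1" if "x \<in> X" for x
    proof -
      have "(\<Sum>y\<in>X. (b x y)\<^sup>2) = (\<Sum>y\<in>X - {x}. (b x y)\<^sup>2)"
        using fin that diag by (subst sum.remove[of X x]) auto
      also have "\<dots> \<le> (\<Sum>y\<in>X - {x}. 1)"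
        using sgn that by (intro sum_mono) (simp add: abs_square_le_1)
      also have "\<dots> = n - 1" using that fin n(3) by (simp add: n_def of_nat_diff)
      finally show ?thesis .
    qed
    then have "(\<Sum>x\<in>X. \<Sum>y\<in>X. (b x y)\<^sup>2) \<le> (\<Sum>x\<in>X. n - 1)" by (rule sum_mono)
    then show ?thesis by (simp add: n_def)
  qed
  have "(n * p * c)\<^sup>2 \<le> (\<Sum>x\<in>X. \<Sum>y\<in>X. (b x y)\<^sup>2) * (\<Sum>x\<in>X. \<Sum>y\<in>X. (Z x y)\<^sup>2)"
    using Cauchy_Schwarz_ineq_sum[of "\<lambda>(x, y). b x y" "\<lambda>(x, y). Z x y" "X \<times> X"]
    unfolding bZ[symmetric] sum.cartesian_product by (simp add: split_def)
  also have "\<dots> \<le> (n * (n - 1)) * (n * p * (n - p))"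
    unfolding ZZ using n by (intro mult_right_mono bb) auto
  finally have "(n\<^sup>2 * p) * (c\<^sup>2 * p) \<le> (n\<^sup>2 * p) * ((n - 1) * (n - p))"
    by (simp add: power2_eq_square algebra_simps)
  moreover have "n\<^sup>2 * p > 0" using n p by simp
  ultimately show ?thesis unfolding n_def[symmetric] by (rule mult_le_cancel_left_pos[THEN iffD1, rotated])
qed

context few_distances
begin

text \<open>The preceding bound for \<open>J - I - 2 A\<^sub>i\<close> and \<open>p = n - N\<close> orthonormal vectors that annihilate all
polynomials of degree less than \<open>s\<close>; the quotient \<open>N (n - 1) / (n - N)\<close> is largest at \<open>n = 2 N\<close>.\<close>
lemma ratio_square_bound:
  assumes "2 * N \<le> card X" "i \<in> {1..s}"
  shows "(2 * k i - 1)\<^sup>2 \<le> 2 * real N - 1"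
proof -
  have N_pos: "N \<ge> 1" using N_split q_pos by linarith
  define p where "p = card X - N"
  have p: "0 < p" "p < card X" using assms(1) N_pos by (auto simp: p_def)
  let ?G = "mon ` {M :: 'n multiset. size M < s}"
  have "card ?G \<le> N" unfolding N_def using finite_multisets_below by (rule card_image_le)
  then have "card ?G + p \<le> card X" using assms(1) by (simp add: p_def)
  from orthonormal_system[OF finite_X finite_imageI[OF finite_multisets_below] this]
  obtain e where e': "\<forall>a<p. \<forall>g\<in>?G. dot X g (e a) = 0"
    "\<forall>a<p. \<forall>b<p. dot X (e a) (e b) = of_bool (a = b)" by (elim exE conjE)
  note e = e'[rule_format]
  define b where "b x y = 1 - of_bool (x = y) - 2 * adj i x y" for x y
  have "dot X (e a) (app X b (e a)) = 2 * k i - 1" if a: "a < p" for a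
  proof -
    let ?v = "e a"
    have kills: "annihilates_below X s ?v" unfolding annihilates_below_def
    proof (intro allI impI)
      fix M :: "'n multiset" assume "size M < s"
      then show "dot X (mon M) ?v = 0" by (intro e(1)[OF a] imageI) simp
    qed
    have "mon {#} = (\<lambda>_ :: real ^ 'n. 1)" by auto
    moreover have "dot X (mon {#}) ?v = 0" using kills s_ge_2 unfolding annihilates_below_def by force
    ultimately have mean: "dot X (\<lambda>_. 1) ?v = 0" by metis
    have row: "dot X (b x) ?v = dot X (\<lambda>_. 1) ?v - ?v x - 2 * dot X (adj i x) ?v" if "x \<in> X" for x
    proof -
      have "(\<Sum>y\<in>X. of_bool (x = y) * ?v y) = ?v x"
        using finite_X that by (subst sum.mono_neutral_right[of X "{x}"]) auto
      then show ?thesis by (simp add: dot_def b_def algebra_simps sum_subtractf sum.distrib sum_distrib_left)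
    qed
    have "dot X ?v (app X b ?v) = (\<Sum>x\<in>X. - (?v x * ?v x) - 2 * (?v x * dot X (adj i x) ?v))"
      unfolding dot_app
    proof (intro sum.cong refl)
      fix x assume "x \<in> X"
      then show "?v x * dot X (b x) ?v = - (?v x * ?v x) - 2 * (?v x * dot X (adj i x) ?v)"
        by (simp only: row mean) (simp add: algebra_simps)
    qed
    also have "\<dots> = - dot X ?v ?v - 2 * dot X ?v (app X (adj i) ?v)"
      unfolding dot_app by (simp add: sum_subtractf sum_distrib_left dot_def[of X ?v ?v] sum_negf)
    also have "\<dots> = 2 * k i - 1"
      using adj_form[OF assms(2) kills] e(2)[OF a a] by simp
    finally show ?thesis .
  qed
  moreover have "b x x = 0" for x using adj_diagonal[OF assms(2)] by (simp add: b_def)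
  moreover have "\<bar>b x y\<bar> \<le> 1" for x y
    using adj_diagonal[OF assms(2), of x] by (cases "x = y") (auto simp: b_def adj_def)
  ultimately have "(2 * k i - 1)\<^sup>2 * p \<le> (real (card X) - 1) * (real (card X) - p)"
    using sign_matrix_compression_bound[OF finite_X, of b p e "2 * k i - 1"] e(2) p by blast
  also have "real (card X) - p = N" using assms(1) by (simp add: p_def of_nat_diff)
  also have "(real (card X) - 1) * N \<le> (2 * real N - 1) * p"
  proof -
    have "0 \<le> (real N - 1) * (real (card X) - 2 * real N)"
      using N_pos assms(1) by (intro mult_nonneg_nonneg) (simp_all flip: of_nat_mult)
    then show ?thesis using assms(1) by (simp add: p_def of_nat_diff algebra_simps)
  qed
  finally show ?thesis using p(1) by simp
qed

end

theorem theorem1p3: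
  fixes X :: "(real ^ 'n::finite) set" and \<alpha> :: "nat \<Rightarrow> real" and s N :: nat
  assumes "s \<ge> 2"
    and "s_distance_set s X"
    and "distances X = \<alpha> ` {1..s}"
    and "N = (CARD('n) + s - 1) choose (s - 1)"
    and "card X \<ge> 2 * N"
  shows "\<forall>i\<in>{1..s}. distance_ratio s \<alpha> i \<in> \<int> \<and>
    \<bar>distance_ratio s \<alpha> i\<bar>
      \<le> real_of_int \<lfloor>1 / 2 + sqrt ((real N)\<^sup>2 / (2 * real N - 2) + 1 / 4)\<rfloor>"
proof -
  have N: "N = card {M :: 'n multiset. size M < s}"
    using card_multisets_below[of s, where 'n = 'n] assms(1,4) by simp
  interpret few_distances X \<alpha> s "card {M :: 'n multiset. size M < s}"
    "card {M :: 'n multiset. size M < s - 1}" "card {M :: 'n multiset. size M = s - 1}"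
  proof unfold_locales
    show "finite X" using assms(2) by (simp add: s_distance_set_def)
    show "inj_on \<alpha> {1..s}"
      using assms(2,3) by (intro eq_card_imp_inj_on) (auto simp: s_distance_set_def)
  qed (use assms in auto)
  have "N \<ge> 2"
  proof -
    have "{M :: 'n multiset. size M < 2} \<subseteq> {M. size M < s}" using assms(1) by auto
    then have "card {M :: 'n multiset. size M < 2} \<le> N"
      unfolding N by (intro card_mono finite_multisets_below)
    moreover have "card {M :: 'n multiset. size M < 2} = Suc CARD('n)"
      by (simp add: card_multisets_below)
    ultimately show ?thesis using zero_less_card_finite[where 'a = 'n] by linarith
  qed
  show ?thesis
  proof (intro ballI conjI)
    fix i assume i: "i \<in> {1..s}"
    show int: "k i \<in> \<int>" using ratio_integer[OF _ i] assms(5) N by simp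
    have "(2 * k i - 1)\<^sup>2 \<le> 2 * real N - 1" using ratio_square_bound[OF _ i] assms(5) N by simp
    also have "\<dots> \<le> 4 * ((real N)\<^sup>2 / (2 * real N - 2) + 1 / 4)"
    proof -
      have "(real N - 1) * (2 * real N - 2) \<le> 2 * (real N)\<^sup>2"
        using \<open>N \<ge> 2\<close> by (simp add: power2_eq_square algebra_simps)
      then show ?thesis using \<open>N \<ge> 2\<close> by (simp add: field_simps)
    qed
    also have "(2 * k i - 1)\<^sup>2 = 4 * (k i - 1 / 2)\<^sup>2" by (simp add: power2_eq_square algebra_simps)
    finally have sq: "(k i - 1 / 2)\<^sup>2 \<le> (real N)\<^sup>2 / (2 * real N - 2) + 1 / 4" by simp
    have "(\<bar>k i\<bar> - 1 / 2)\<^sup>2 \<le> (k i - 1 / 2)\<^sup>2"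
      by (cases "k i \<ge> 0") (simp_all add: power2_eq_square algebra_simps)
    then have "\<bar>k i\<bar> - 1 / 2 \<le> sqrt ((real N)\<^sup>2 / (2 * real N - 2) + 1 / 4)"
      using sq by (intro real_le_rsqrt) linarith
    then have le: "\<bar>k i\<bar> \<le> 1 / 2 + sqrt ((real N)\<^sup>2 / (2 * real N - 2) + 1 / 4)" by simp
    obtain m where m: "\<bar>k i\<bar> = real_of_int m" using int Ints_abs Ints_cases by metis
    show "\<bar>k i\<bar> \<le> real_of_int \<lfloor>1 / 2 + sqrt ((real N)\<^sup>2 / (2 * real N - 2) + 1 / 4)\<rfloor>"
      using le unfolding m by (simp add: le_floor_iff)
  qed
qed

end
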